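(* Let $p$ be a prime. Then \[ \deg ss^{(2* )}_{p}(X) = L^{(2* )}(p) \iff p\mid \# \mathbb{B},\qquad \deg ss^{(3* )}_{p}(X) = L^{(3* )}(p) \iff p\mid \# Fi^{\prime}_{24},\] where $\#\mathbb{B}=2^{41}\cdot 3^{13}\cdot 5^{6} \cdot 7^{2} \cdot 11\cdot 13 \cdot 17 \cdot 19 \cdot 23 \cdot 31 \cdot 47$ is the order of the Baby Monster group and $\#Fi'_{24}=2^{21}\cdot 3^{16}\cdot 5^{2}\cdot 7^{3}\cdot 11\cdot 13\cdot 17\cdot 23\cdot 29$ is the order of the Fischer group $Fi'_{24}$.
   Context: For a prime $p\ge5$ let $\nu=\tfrac12(1-(\tfrac{-2}{p}))$, $\delta=\tfrac12(1-(\tfrac{-3}{p}))$, $\varepsilon=\tfrac12(1-(\tfrac{-1}{p}))$ (Legendre symbols), $m_2=[p/8]$, $m_3=[p/6]$, and define in $\mathbb{F}_p[X]$ $ss^{(2* )}_{p} (X) = X^{m_{2}+\varepsilon} (X-256)^{\nu } {}_{2}F_{1}( -m_{2} ,\tfrac{3}{8}-\tfrac{\varepsilon-2\nu}{4};1;\tfrac{256}{X} ) \bmod p$ and $ss^{(3* )}_{p} (X) = X^{m_{3}+\delta} (X-108)^{\delta } {}_{2}F_{1}( -m_{3} ,\tfrac{1}{3}+\tfrac{\delta}{3};1;\tfrac{108}{X} ) \bmod p$, where ${}_2F_1(-m,\beta;1;x)=\sum_{n=0}^{m}\frac{(-m)_n(\beta)_n}{(n!)^2}x^n$ with Pochhammer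 symbols $(a)_n=a(a+1)\cdots(a+n-1)$, and "$\bmod p$" means reducing the (p-integral rational) coefficients into $\mathbb{F}_p$. For $p\in\{2,3\}$ and $N\in\{2,3\}$ one sets $ss^{(N* )}_p(X)=X\in\mathbb{F}_p[X]$. For $N\in\{2,3\}$, $L^{(N* )}(p)$ denotes the number of linear factors of $ss^{(N* )}_p(X)$ in its factorization into irreducibles in $\mathbb{F}_p[X]$. *)

theory Defs
  imports
    "HOL-Computational_Algebra.Polynomial_Factorial"
    "HOL-Number_Theory.Residues"
    "Berlekamp_Zassenhaus.Finite_Field"
begin

text \<open>
  The field with p elements is \<^typ>\<open>'p mod_ring\<close> for \<^typ>\<open>'p::prime_card\<close>, the prime
  p being CARD('p).
\<close>

text \<open>
  Each of the following three is \<open>(1 - (a/p)) / 2\<close>; the division is exact and the value is 0 or 1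
  whenever p does not divide a.
\<close>

definition nu :: "nat \<Rightarrow> nat" where
  "nu p = nat ((1 - Legendre (-2) (int p)) div 2)"

definition delta :: "nat \<Rightarrow> nat" where
  "delta p = nat ((1 - Legendre (-3) (int p)) div 2)"

definition eps :: "nat \<Rightarrow> nat" where
  "eps p = nat ((1 - Legendre (-1) (int p)) div 2)"

definition hyp2F1_coeff :: "nat \<Rightarrow> rat \<Rightarrow> nat \<Rightarrow> rat" where
  "hyp2F1_coeff m \<beta> n = pochhammer (- of_nat m) n * pochhammer \<beta> n / (fact n)\<^sup>2"

text \<open>
  The polynomial \<open>X^k * 2F1(-m, \<beta>; 1; c/X)\<close>, to be used for \<open>k \<ge> m\<close> only, so that the
  subtraction of natural numbers in the exponent is exact.
\<close>

definition hyp2F1_rev_poly :: "nat \<Rightarrow> nat \<Rightarrow> rat \<Rightarrow> rat \<Rightarrow> rat poly" where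
  "hyp2F1_rev_poly k m \<beta> c = (\<Sum>n\<le>m. monom (hyp2F1_coeff m \<beta> n * c ^ n) (k - n))"

definition ss2_rat :: "nat \<Rightarrow> rat poly" where
  "ss2_rat p =
     hyp2F1_rev_poly (p div 8 + eps p) (p div 8)
       (3 / 8 - (of_nat (eps p) - 2 * of_nat (nu p)) / 4) 256
     * [:-256, 1:] ^ nu p"

definition ss3_rat :: "nat \<Rightarrow> rat poly" where
  "ss3_rat p =
     hyp2F1_rev_poly (p div 6 + delta p) (p div 6)
       (1 / 3 + of_nat (delta p) / 3) 108
     * [:-108, 1:] ^ delta p"

text \<open>
  Reduction modulo p of a p-integral rational number. On rationals that are not p-integral the
  denominator becomes 0 and the value is meaningless.
\<close>

definition rat_mod :: "rat \<Rightarrow> 'p::prime_card mod_ring" where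
  "rat_mod r = of_int (fst (quotient_of r)) / of_int (snd (quotient_of r))"

definition ss2 :: "'p::prime_card mod_ring poly" where
  "ss2 = (if CARD('p) \<in> {2, 3} then [:0, 1:] else map_poly rat_mod (ss2_rat CARD('p)))"

definition ss3 :: "'p::prime_card mod_ring poly" where
  "ss3 = (if CARD('p) \<in> {2, 3} then [:0, 1:] else map_poly rat_mod (ss3_rat CARD('p)))"

text \<open>Linear factors are counted with multiplicity.\<close>

definition num_linear_factors :: "'p::prime_card mod_ring poly \<Rightarrow> nat" where
  "num_linear_factors f = size {#q \<in># prime_factorization f. degree q = 1#}"

definition order_Baby_Monster :: nat where
  "order_Baby_Monster =
     2^41 * 3^13 * 5^6 * 7^2 * 11 * 13 * 17 * 19 * 23 * 31 * 47"

definition order_Fischer_24' :: nat where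
  "order_Fischer_24' =
     2^21 * 3^16 * 5^2 * 7^3 * 11 * 13 * 17 * 23 * 29"

end

theory Submission
  imports Defs "HOL-Computational_Algebra.Formal_Laurent_Series" "HOL-Computational_Algebra.Polynomial_FPS"
    "HOL-Number_Theory.Quadratic_Reciprocity"
begin

text \<open>
  Modulo \<open>p\<close> both polynomials are, up to linear factors, reversals of
  \<open>f = (\<Sum>n\<le>m. (m choose n) (b choose n) z\<^sup>n)\<close> with \<open>(m, b) = (p div 8, 3 p div 8)\<close> and
  \<open>(m, b) = (p div 6, p div 3)\<close> respectively. This \<open>f\<close> solves a hypergeometric equation, so
  its \<open>m\<close> roots are simple. That it does not split for large \<open>p\<close> is shown by Stepanov's method. Put
  \<open>g = z f'\<close>. If all roots of \<open>f\<close> lie in the prime field, then counting parameters gives forms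
  \<open>A, B\<close> of degree \<open>D\<close> in \<open>(f, g)\<close>, with coefficients of degree at most \<open>H\<close> in \<open>z\<close> and not both zero,
  such that \<open>\<Phi> = A(f, g) + z\<^sup>p\<^sup>-\<^sup>1 B(f, g)\<close> vanishes to order \<open>M\<close> at every root: at a root, \<open>f\<close> is \<open>0\<close>,
  \<open>z\<^sup>p\<^sup>-\<^sup>1\<close> is \<open>1\<close>, and all derivatives reduce to multiples of \<open>g\<^sup>D\<close> by the differential equation.
  Comparing degrees, \<open>\<Phi> = 0\<close>. Differentiating this relation shows that \<open>A / B\<close> is an eigenfunction
  of the Riccati derivation, which is impossible because of the logarithmic singularity at
  \<open>z = 0\<close>. For the remaining \<open>p\<close> the polynomial is either split by explicit roots or has an explicit
  irreducible quadratic factor.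
\<close>

section \<open>Darboux polynomials of a Riccati derivation\<close>

text \<open>The vanishing conditions at the roots are imposed as identities in \<open>z\<close>, not
  root by root: the n-th one says that a polynomial of degree at most \<open>H + n\<close> is zero,
  so their number does not depend on the number \<open>m\<close> of roots. The degree comparison
  requires \<open>M > D + (p - 1) / m\<close>. With \<open>A\<close> alone there are
  \<open>(D + 1) * (H + 1)\<close> unknowns against at least \<open>M * (H + 1)\<close> conditions,
  which is too few; the form \<open>B\<close>, whose factor \<open>z ^ (p - 1)\<close> is 1 at the
  roots, doubles the unknowns without new conditions. The price is that \<open>\<Phi>\<close> might
  vanish although \<open>A\<close> and \<open>B\<close> do not. To exclude this, put
  \<open>v = g / f\<close> and \<open>\<kappa> = (1 - z) ^ (m + b) / f ^ 2\<close>. With ' for z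
  d/dz, the substitution \<open>S = v + \<kappa> * T\<close> turns the Riccati equation into
  \<open>T' = - \<kappa> * T ^ 2\<close>, so that \<open>1 / T\<close> is a primitive of
  \<open>\<kappa>\<close>. As \<open>\<kappa>\<close> has constant term 1 and z d/dz kills constant
  terms, \<open>i * \<kappa>\<close> has no primitive among the Laurent series for 0 < |i| <
  p.\<close>

locale derivation =
  fixes D :: "'k::field \<Rightarrow> 'k"
  assumes D_add: "D (x + y) = D x + D y"
    and D_mult: "D (x * y) = D x * y + x * D y"
begin

lemma D_0 [simp]: "D 0 = 0"
  using D_add[of 0 0] by (metis add_0 add_cancel_right_right)

lemma D_sum: "D (sum f A) = (\<Sum>x\<in>A. D (f x))"
  by (induction A rule: infinite_finite_induct) (simp_all add: D_add)

lemma D_divide: "D (x / y) = (D x * y - x * D y) / y\<^sup>2" if "y \<noteq> 0"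
proof -
  have "D x = D (x / y * y)" using that by simp
  also have "\<dots> = D (x / y) * y + x / y * D y" by (rule D_mult)
  finally show ?thesis using that by (simp add: field_simps power2_eq_square)
qed

lemma coeff_map_poly_D [simp]: "coeff (map_poly D P) n = D (coeff P n)"
  by (simp add: coeff_map_poly)

lemma map_poly_D_add: "map_poly D (P + Q) = map_poly D P + map_poly D Q"
  by (rule poly_eqI) (simp add: D_add)

lemma map_poly_D_mult: "map_poly D (P * Q) = map_poly D P * Q + P * map_poly D Q"
  by (rule poly_eqI) (simp add: coeff_mult D_sum D_mult sum.distrib)

lemma map_poly_D_pcompose:
  "map_poly D (P \<circ>\<^sub>p q) = map_poly D P \<circ>\<^sub>p q + (pderiv P \<circ>\<^sub>p q) * map_poly D q"
proof (induction P)
  case 0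
  then show ?case by simp
next
  case (pCons a P)
  have 1: "map_poly D (pCons c Q) = pCons (D c) (map_poly D Q)" for c Q
    by (rule poly_eqI) (simp add: coeff_pCons split: nat.split)
  show ?case
    by (simp add: pcompose_pCons map_poly_D_add map_poly_D_mult pCons.IH 1
        pderiv_pCons pcompose_add algebra_simps)
qed

end

text \<open>This is the reduced form of the fraction \<open>A / B\<close>, found by division with
  remainder: a nonzero remainder of \<open>B'\<close> modulo \<open>B0\<close> would again be a
  denominator of \<open>A / B\<close>, of smaller degree.\<close>

lemma minimal_proportional_pair:
  fixes A B :: "'k::field poly"
  assumes "B \<noteq> 0"
  obtains A0 B0 where "B0 \<noteq> 0" "A * B0 = A0 * B"
    and "\<forall>A' B'. A' * B0 = A0 * B' \<longrightarrow> (\<exists>q. A' = q * A0 \<and> B' = q * B0)"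
proof -
  define P where "P = (\<lambda>B0. B0 \<noteq> 0 \<and> (\<exists>A0. A * B0 = A0 * B))"
  have "P B" using assms by (auto simp: P_def)
  from ex_has_least_nat[of P, OF this, of degree] obtain B0
    where B0: "P B0" "\<And>B'. P B' \<Longrightarrow> degree B0 \<le> degree B'" by blast
  then obtain A0 where A0: "B0 \<noteq> 0" "A * B0 = A0 * B" by (auto simp: P_def)
  have "\<exists>q. A' = q * A0 \<and> B' = q * B0" if "A' * B0 = A0 * B'" for A' B'
  proof -
    define q where "q = B' div B0"
    define r where "r = B' mod B0"
    have r: "r = B' - q * B0" by (simp add: q_def r_def minus_div_mult_eq_mod)
    have eq: "(A' - q * A0) * B0 = A0 * r" using that by (simp add: r algebra_simps)
    have "r = 0"
    proof (rule ccontr)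
      assume "r \<noteq> 0"
      have "B0 * (A * r) = B0 * ((A' - q * A0) * B)" using eq A0(2) by (metis mult.assoc mult.commute)
      hence "A * r = (A' - q * A0) * B" using A0(1) by simp
      hence "P r" using \<open>r \<noteq> 0\<close> by (auto simp: P_def)
      hence "degree B0 \<le> degree r" by (rule B0(2))
      moreover have "degree r < degree B0"
        using degree_mod_less'[of B0 B'] A0(1) \<open>r \<noteq> 0\<close> by (simp add: r_def)
      ultimately show False by simp
    qed
    with eq A0(1) r show ?thesis by auto
  qed
  with A0 show ?thesis using that by blast
qed

context derivation
begin

text \<open>The top coefficient of \<open>P\<close> determines \<open>l1\<close>. The quotient of
  the two lowest coefficients then has derivative \<open>(i - n) * \<kappa>\<close>, so by the
  hypothesis on \<open>\<kappa>\<close> the lowest index \<open>i\<close> equals the degree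
  \<open>n\<close>.\<close>

lemma darboux_poly_monom:
  assumes \<kappa>: "\<forall>c i. \<bar>i\<bar> \<le> int N \<longrightarrow> D c = of_int i * \<kappa> \<longrightarrow> i = 0"
    and P: "P \<noteq> 0" "degree P \<le> N"
    and eq: "map_poly D P - monom \<kappa> 2 * pderiv P = [:l0, l1:] * P"
  obtains a where "a \<noteq> 0" "P = monom a (degree P)" "l1 = - (of_nat (degree P) * \<kappa>)"
proof -
  define n where "n = degree P"
  define i where "i = (LEAST i. coeff P i \<noteq> 0)"
  have lead: "coeff P n \<noteq> 0" using P by (simp add: n_def)
  hence i: "coeff P i \<noteq> 0" unfolding i_def by (rule LeastI)
  have below: "coeff P k = 0" if "k < i" for k using not_less_Least[of k] that by (auto simp: i_def)
  have c: "coeff (monom \<kappa> 2 * pderiv P) (Suc k) = \<kappa> * of_nat k * coeff P k" for k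
    by (cases k) (auto simp: coeff_monom_mult coeff_pderiv)
  have rec: "D (coeff P (Suc k)) - \<kappa> * of_nat k * coeff P k = l0 * coeff P (Suc k) + l1 * coeff P k" for k
  proof -
    have "coeff (map_poly D P - monom \<kappa> 2 * pderiv P) (Suc k) = coeff ([:l0, l1:] * P) (Suc k)"
      using eq by simp
    thus ?thesis by (simp only: coeff_diff c coeff_map_poly_D) simp
  qed
  have "coeff P (Suc n) = 0" by (simp add: n_def coeff_eq_0)
  hence "coeff P n * l1 = coeff P n * - (of_nat n * \<kappa>)" using rec[of n] by (simp add: mult_ac)
  hence l1: "l1 = - (of_nat n * \<kappa>)" by (rule mult_left_cancel[OF lead, THEN iffD1])
  have i0: "D (coeff P i) = l0 * coeff P i"
  proof (cases i)
    case 0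
    have "coeff (map_poly D P - monom \<kappa> 2 * pderiv P) 0 = coeff ([:l0, l1:] * P) 0"
      using eq by simp
    thus ?thesis using 0 by (simp add: coeff_monom_mult)
  next
    case (Suc k)
    with rec[of k] below[of k] show ?thesis by simp
  qed
  \<comment> \<open>The terms with \<open>l0\<close> cancel, because \<open>D\<close> acts on
    \<open>coeff P i\<close> as multiplication by \<open>l0\<close>.\<close>
  have "D (coeff P (Suc i) / coeff P i) = of_nat i * \<kappa> + l1"
    using rec[of i] i i0 by (simp add: D_divide field_simps power2_eq_square)
  hence "D (coeff P (Suc i) / coeff P i) = of_int (int i - int n) * \<kappa>"
    by (simp add: l1 algebra_simps)
  moreover have "i \<le> n" using i by (simp add: n_def le_degree)
  ultimately have "i = n" using \<kappa>[rule_format, of "int i - int n"] P(2) by (simp add: n_def)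
  hence "P = monom (coeff P n) n"
    using below by (intro poly_eqI) (metis coeff_eq_0 coeff_monom linorder_neqE_nat n_def)
  with lead l1 show ?thesis using that[of "coeff P n"] unfolding n_def by blast
qed

text \<open>
  The degrees of \<open>A\<^sub>0\<close> and \<open>B\<^sub>0\<close> being minimal, both are invariant under the derivation up to a
  factor, and an invariant polynomial must be a power of the variable.
\<close>

lemma proportional_of_invariant_quotient:
  assumes \<kappa>: "\<forall>c i. \<bar>i\<bar> \<le> int N \<longrightarrow> D c = of_int i * \<kappa> \<longrightarrow> i = 0"
    and deg: "degree A \<le> N" "degree B \<le> N" and B: "B \<noteq> 0"
    and eq: "A * (map_poly D B - monom \<kappa> 2 * pderiv B - smult \<mu> B) =
             B * (map_poly D A - monom \<kappa> 2 * pderiv A)"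
  obtains r where "A = smult r B"
proof (cases "A = 0")
  case True
  then show ?thesis using that[of 0] by simp
next
  case False
  let ?d = "\<lambda>P. map_poly D P - monom \<kappa> 2 * pderiv P"
  obtain A0 B0 where *: "B0 \<noteq> 0" "A * B0 = A0 * B"
    and min: "\<forall>A' B'. A' * B0 = A0 * B' \<longrightarrow> (\<exists>q. A' = q * A0 \<and> B' = q * B0)"
    by (rule minimal_proportional_pair[OF B, of A])
  from min[rule_format, OF *(2)] obtain t where t: "A = t * A0" "B = t * B0" by blast
  have "t \<noteq> 0" and A0: "A0 \<noteq> 0" using t False by auto
  have d_mult: "?d (P * Q) = ?d P * Q + P * ?d Q" for P Q
    by (simp add: map_poly_D_mult pderiv_mult algebra_simps)
  have "t * t * (?d A0 * B0) = t * t * (A0 * (?d B0 - smult \<mu> B0))"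
    using eq unfolding t d_mult by (simp add: algebra_simps)
  hence "?d A0 * B0 = A0 * (?d B0 - smult \<mu> B0)"
    using \<open>t \<noteq> 0\<close> by simp
  \<comment> \<open>The derived pair is again proportional to \<open>(A0, B0)\<close>, hence a
    common multiple of it: both polynomials are invariant, with cofactors that differ only by the
    constant \<open>\<mu>\<close>.\<close>
  from min[rule_format, OF this] obtain q where q: "?d A0 = q * A0" "?d B0 - smult \<mu> B0 = q * B0" by blast
  have "degree (?d A0) \<le> degree A0 + 1"
  proof (rule degree_le, intro allI impI)
    fix i assume "degree A0 + 1 < i"
    then obtain k where "i = Suc (Suc k)" "degree A0 < Suc k"
      by (intro that[of "i - 2"]) auto
    thus "coeff (?d A0) i = 0"
      by (simp add: coeff_monom_mult coeff_pderiv coeff_eq_0)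
  qed
  hence "degree q \<le> 1"
    using A0 by (cases "q = 0") (auto simp: q(1) degree_mult_eq)
  then have "q = [:coeff q 0, coeff q 1:]"
    by (intro poly_eqI) (auto simp: coeff_pCons coeff_eq_0 split: nat.split)
  then obtain l0 l1 where l: "q = [:l0, l1:]" by blast
  have degs: "degree A0 \<le> N" "degree B0 \<le> N"
    using deg \<open>t \<noteq> 0\<close> A0 *(1) by (simp_all add: t degree_mult_eq)
  obtain a where a: "a \<noteq> 0" "A0 = monom a (degree A0)" "l1 = - (of_nat (degree A0) * \<kappa>)"
    using darboux_poly_monom[OF \<kappa> A0 degs(1) q(1)[unfolded l]] by blast
  have "?d B0 = [:l0 + \<mu>, l1:] * B0"
    using q(2) l by (simp add: algebra_simps smult_add_left)
  then obtain b where b: "b \<noteq> 0" "B0 = monom b (degree B0)" "l1 = - (of_nat (degree B0) * \<kappa>)"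
    using darboux_poly_monom[OF \<kappa> *(1) degs(2)] by blast
  \<comment> \<open>Both cofactors have the same \<open>l1\<close>. The hypothesis on
    \<open>\<kappa>\<close> with \<open>c = 0\<close> does the work of a condition on the
    characteristic and makes the degrees equal.\<close>
  have "D 0 = of_int (int (degree A0) - int (degree B0)) * \<kappa>"
    using a(3) b(3) by (simp add: algebra_simps)
  with \<kappa>[rule_format, of "int (degree A0) - int (degree B0)" 0] degs have "degree A0 = degree B0" by simp
  hence "A0 = smult (a / b) B0"
    by (subst a(2), subst b(2)) (use b(1) in \<open>simp add: smult_monom\<close>)
  hence "A = smult (a / b) B" by (simp add: t)
  thus ?thesis by (rule that)
qed

text \<open>Composition with \<open>[:v, \<kappa>:]\<close>, where \<open>v\<close> is one solution
  of the Riccati equation, removes the constant and the linear term and leaves the derivation with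
  \<open>- \<kappa> * T ^ 2\<close>, to which the preceding lemma applies.\<close>

lemma riccati_proportional_of_invariant_quotient:
  assumes \<kappa>: "\<forall>c i. \<bar>i\<bar> \<le> int N \<longrightarrow> D c = of_int i * \<kappa> \<longrightarrow> i = 0"
    and deg: "degree A \<le> N" "degree B \<le> N" and B: "B \<noteq> 0"
    and v: "D v = r0 + r1 * v - v\<^sup>2" and D\<kappa>: "D \<kappa> = (r1 - 2 * v) * \<kappa>" and \<kappa>0: "\<kappa> \<noteq> 0"
    and eq: "A * (map_poly D B + [:r0, r1, -1:] * pderiv B - smult \<mu> B) =
             B * (map_poly D A + [:r0, r1, -1:] * pderiv A)"
  obtains r where "A = smult r B"
proof -
  define q where "q = [:v, \<kappa>:]"
  have q0: "degree q > 0" by (simp add: q_def \<kappa>0)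
  have Dq: "map_poly D q = [:D v, D \<kappa>:]"
    by (rule poly_eqI) (simp add: q_def coeff_pCons split: nat.split)
  define R where "R = [:r0, r1, -1:]"
  have ric: "R \<circ>\<^sub>p q = map_poly D q - smult \<kappa> (monom \<kappa> 2)"
    by (simp add: Dq v D\<kappa>)
       (simp add: q_def R_def pcompose_pCons smult_monom monom_altdef algebra_simps power2_eq_square)
  have sub: "(map_poly D P + R * pderiv P) \<circ>\<^sub>p q =
      map_poly D (P \<circ>\<^sub>p q) - monom \<kappa> 2 * pderiv (P \<circ>\<^sub>p q)" for P
  proof -
    have "pderiv q = [:\<kappa>:]" by (simp add: q_def pderiv_pCons)
    thus ?thesis
      by (simp add: pcompose_add pcompose_mult ric pderiv_pcompose map_poly_D_pcompose algebra_simps)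
  qed
  have degle: "degree (P \<circ>\<^sub>p q) \<le> N" if "degree P \<le> N" for P
    using that degree_pcompose[of P q] by (simp add: q_def \<kappa>0)
  have "B \<circ>\<^sub>p q \<noteq> 0" using B pcompose_eq_0[OF _ q0] by blast
  moreover have "(A \<circ>\<^sub>p q) * (map_poly D (B \<circ>\<^sub>p q) - monom \<kappa> 2 * pderiv (B \<circ>\<^sub>p q) - smult \<mu> (B \<circ>\<^sub>p q)) =
      (B \<circ>\<^sub>p q) * (map_poly D (A \<circ>\<^sub>p q) - monom \<kappa> 2 * pderiv (A \<circ>\<^sub>p q))"
    using arg_cong[OF eq[folded R_def], of "\<lambda>P. P \<circ>\<^sub>p q"]
    by (simp add: pcompose_mult pcompose_diff sub pcompose_smult)
  ultimately obtain r where "A \<circ>\<^sub>p q = smult r (B \<circ>\<^sub>p q)"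
    using proportional_of_invariant_quotient[OF \<kappa> degle[OF deg(1)] degle[OF deg(2)]] by blast
  hence "(A - smult r B) \<circ>\<^sub>p q = 0" by (simp add: pcompose_diff pcompose_smult)
  hence "A - smult r B = 0" by (rule pcompose_eq_0[OF _ q0])
  thus ?thesis using that[of r] by simp
qed

end

section \<open>The hypergeometric polynomial and its differential equation\<close>

text \<open>This is 2F1(-m, -b; 1; z): the signs of the two Pochhammer symbols cancel.\<close>

definition hyp_poly :: "nat \<Rightarrow> nat \<Rightarrow> 'a::comm_ring_1 poly" where
  "hyp_poly m b = (\<Sum>n\<le>m. monom (of_nat ((m choose n) * (b choose n))) n)"

lemma coeff_hyp_poly: "coeff (hyp_poly m b) n = of_nat ((m choose n) * (b choose n))"
  by (cases "n \<le> m") (auto simp: hyp_poly_def coeff_sum binomial_eq_0)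

text \<open>The factor \<open>1 - z\<close> clears the denominator of the hypergeometric equation,
  so that the ring generated by \<open>f\<close> and \<open>z * f'\<close> over the polynomials in
  \<open>z\<close> is stable.\<close>

definition euler_deriv :: "'a::idom poly \<Rightarrow> 'a poly" where
  "euler_deriv f = [:0, 1, -1:] * pderiv f"

lemma euler_deriv_add: "euler_deriv (f + g) = euler_deriv f + euler_deriv g"
  by (simp only: euler_deriv_def pderiv_add distrib_left)

lemma euler_deriv_diff: "euler_deriv (f - g) = euler_deriv f - euler_deriv g"
  by (simp only: euler_deriv_def pderiv_diff right_diff_distrib)

lemma euler_deriv_0 [simp]: "euler_deriv 0 = 0"
  by (simp add: euler_deriv_def)

lemma euler_deriv_sum: "euler_deriv (sum f A) = (\<Sum>x\<in>A. euler_deriv (f x))"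
  by (induction A rule: infinite_finite_induct) (simp_all add: euler_deriv_add)

lemma euler_deriv_mult: "euler_deriv (f * g) = euler_deriv f * g + f * euler_deriv g"
  unfolding euler_deriv_def pderiv_mult by (simp only: distrib_left mult_ac add_ac)

lemma euler_deriv_power: "euler_deriv (f ^ n) = of_nat n * f ^ (n - 1) * euler_deriv f"
proof (cases n)
  case (Suc k)
  show ?thesis unfolding Suc
    by (induction k) (simp_all add: euler_deriv_mult algebra_simps)
qed (simp add: euler_deriv_def)

lemma degree_euler_deriv_le: "degree (euler_deriv f) \<le> degree f + 1"
proof (cases "degree f = 0")
  case True
  then show ?thesis by (auto simp: euler_deriv_def pderiv_pCons elim!: degree_eq_zeroE)
next
  case False
  have "degree (euler_deriv f) \<le> degree [:0, 1, -1::'a:] + degree (pderiv f)"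
    unfolding euler_deriv_def by (rule degree_mult_le)
  also have "\<dots> \<le> 2 + (degree f - 1)"
    by (intro add_mono degree_pderiv_le) auto
  finally show ?thesis using False by simp
qed

lemma coeff_euler_deriv: "coeff (euler_deriv f) (Suc n) = of_nat (Suc n) * coeff f (Suc n) - of_nat n * coeff f n"
  "coeff (euler_deriv f) 0 = 0"
  by (auto simp: euler_deriv_def coeff_pderiv coeff_pCons split: nat.split)

text \<open>At \<open>a\<close> only the term survives in which each of the \<open>k\<close>
  differentiations hits the power of the linear factor.\<close>

lemma euler_deriv_iterate_at_zero:
  fixes a :: "'a::idom"
  shows "poly ((euler_deriv ^^ k) ([:- a, 1:] ^ k * q)) a = of_nat (fact k) * (a * (1 - a)) ^ k * poly q a"
proof (induction k arbitrary: q)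
  case (Suc k)
  have euler_deriv_linear: "euler_deriv [:- a, 1:] = [:0, 1, -1:]"
    by (simp add: euler_deriv_def pderiv_pCons)
  have "euler_deriv ([:- a, 1:] ^ Suc k * q) =
      [:- a, 1:] ^ k * (of_nat (Suc k) * [:0, 1, -1:] * q + [:- a, 1:] * euler_deriv q)"
    unfolding euler_deriv_mult euler_deriv_power euler_deriv_linear by (simp only: distrib_left mult_ac power_Suc diff_Suc_1)
  hence "poly ((euler_deriv ^^ Suc k) ([:- a, 1:] ^ Suc k * q)) a =
      poly ((euler_deriv ^^ k) ([:- a, 1:] ^ k * (of_nat (Suc k) * [:0, 1, -1:] * q + [:- a, 1:] * euler_deriv q))) a"
    by (simp add: funpow_swap1)
  also have "\<dots> = of_nat (fact (Suc k)) * (a * (1 - a)) ^ Suc k * poly q a"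
    unfolding Suc.IH by (simp add: algebra_simps)
  finally show ?case .
qed simp

text \<open>A Taylor criterion in positive characteristic: the invertible factor
  \<open>fact n * (a * (1 - a)) ^ n\<close> is what restricts both \<open>M\<close> and
  \<open>a\<close>.\<close>

lemma power_dvd_of_euler_deriv_iterates:
  fixes a :: "'a::field"
  assumes "\<And>n. n < M \<Longrightarrow> poly ((euler_deriv ^^ n) q) a = 0"
    and "a \<noteq> 0" "a \<noteq> 1" and fact: "\<And>n. n < M \<Longrightarrow> of_nat (fact n) \<noteq> (0::'a)"
  shows "[:- a, 1:] ^ M dvd q"
  using assms(1) fact
proof (induction M)
  case (Suc M)
  then obtain r where r: "q = [:- a, 1:] ^ M * r" by (auto elim: dvdE)
  have "poly ((euler_deriv ^^ M) q) a = 0" using Suc.prems by simp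
  hence "of_nat (fact M) * (a * (1 - a)) ^ M * poly r a = 0" unfolding r euler_deriv_iterate_at_zero .
  hence "poly r a = 0" using Suc.prems(2)[of M] assms by simp
  hence "[:- a, 1:] dvd r" by (simp add: poly_eq_0_iff_dvd)
  thus ?case unfolding r power_Suc2 by (rule mult_dvd_mono[OF dvd_refl])
qed simp

text \<open>On coefficients this is the recurrence
  \<open>(n + 1) ^ 2 * c (n + 1) = (m - n) * (b - n) * c n\<close>.\<close>

lemma hyp_poly_ode:
  fixes m b :: nat
  defines "f \<equiv> (hyp_poly m b :: 'a::idom poly)"
  defines "g \<equiv> [:0, 1:] * pderiv f"
  shows "euler_deriv g = [:0, 1:] * (of_nat (m * b) * f - of_nat (m + b) * g)"
proof (rule poly_eqI)
  fix n
  have g: "coeff g n = of_nat n * coeff f n" for n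
    by (auto simp: g_def coeff_pderiv coeff_pCons split: nat.split)
  have of_nat_coeff: "coeff (of_nat k * q) n = of_nat k * coeff q n" for k n and q :: "'a poly"
    by (simp add: of_nat_poly)
  show "coeff (euler_deriv g) n = coeff ([:0, 1:] * (of_nat (m * b) * f - of_nat (m + b) * g)) n"
  proof (cases n)
    case (Suc k)
    have choose: "int (Suc k) * int (j choose Suc k) = (int j - int k) * int (j choose k)" for j
    proof (cases "k \<le> j")
      case True
      have "Suc k * (j choose Suc k) = (j - k) * (j choose k)"
        by (simp only: binomial_absorb_comp binomial_absorption)
      thus ?thesis using True by (metis of_nat_diff of_nat_mult)
    qed (simp add: binomial_eq_0)
    have "int (Suc k) * int (Suc k) * int ((m choose Suc k) * (b choose Suc k)) =
       (int (Suc k) * int (m choose Suc k)) * (int (Suc k) * int (b choose Suc k))" by simp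
    also have "\<dots> = (int m - int k) * (int b - int k) * int ((m choose k) * (b choose k))"
      unfolding choose by simp
    finally have "of_int (int (Suc k) * int (Suc k) * int ((m choose Suc k) * (b choose Suc k))) =
      (of_int ((int m - int k) * (int b - int k) * int ((m choose k) * (b choose k))) :: 'a)" by simp
    hence rec: "of_nat (Suc k) * of_nat (Suc k) * coeff f (Suc k) =
       (of_nat m - of_nat k) * (of_nat b - of_nat k) * coeff f k"
      by (simp only: of_int_mult of_int_diff of_int_of_nat_eq f_def coeff_hyp_poly)
    have rhs: "coeff ([:0, 1:] * (of_nat (m * b) * f - of_nat (m + b) * g)) (Suc k) =
        of_nat (m * b) * coeff f k - of_nat (m + b) * coeff g k"
      by (simp add: of_nat_coeff del: of_nat_mult of_nat_add)
    from rec show ?thesis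
      unfolding Suc rhs by (simp add: coeff_euler_deriv g algebra_simps)
  qed (simp add: coeff_euler_deriv)
qed

section \<open>Forms in the hypergeometric polynomial and its derivative\<close>

text \<open>Pigeonhole: there are more vectors indexed by \<open>I\<close> than value tuples indexed
  by \<open>J\<close>, and the difference of two vectors with equal values is a common zero.\<close>

lemma nontrivial_common_zero:
  fixes L :: "'j \<Rightarrow> ('i \<Rightarrow> 'a::{finite,ring_1}) \<Rightarrow> 'a"
  assumes fin: "finite I" "finite J" and card: "card J < card I"
    and diff: "\<And>j h h'. L j (\<lambda>i. h i - h' i) = L j h - L j h'"
  obtains h where "\<exists>i\<in>I. h i \<noteq> 0" "\<And>j. j \<in> J \<Longrightarrow> L j h = 0"
proof -
  let ?X = "PiE I (\<lambda>_. UNIV :: 'a set)" and ?Y = "PiE J (\<lambda>_. UNIV :: 'a set)"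
  define T where "T = (\<lambda>h. restrict (\<lambda>j. L j h) J)"
  have "card {0, 1 :: 'a} \<le> CARD('a)" by (rule card_mono) auto
  hence "CARD('a) > 1" by simp
  hence "card ?Y < card ?X" using fin card by (simp add: card_PiE)
  moreover have "T ` ?X \<subseteq> ?Y" by (auto simp: T_def)
  moreover have "finite ?Y" using fin by (intro finite_PiE) auto
  ultimately have "\<not> inj_on T ?X" by (meson card_inj_on_le leD)
  then obtain h1 h2 where h: "h1 \<in> ?X" "h2 \<in> ?X" "T h1 = T h2" "h1 \<noteq> h2"
    by (auto simp: inj_on_def)
  show ?thesis
  proof
    show "\<exists>i\<in>I. h1 i - h2 i \<noteq> 0"
      using h PiE_ext[OF h(1,2)] by auto
    show "L j (\<lambda>i. h1 i - h2 i) = 0" if "j \<in> J" for j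
      using fun_cong[OF h(3), of j] that by (simp add: diff T_def)
  qed
qed

definition form_of :: "nat \<Rightarrow> nat \<Rightarrow> (nat \<Rightarrow> nat \<Rightarrow> 'a::comm_ring_1) \<Rightarrow> 'a poly poly" where
  "form_of D H h = (\<Sum>j\<le>D. monom (\<Sum>i\<le>H. monom (h j i) i) j)"

lemma coeff_form_of:
  "coeff (coeff (form_of D H h) j) i = (if j \<le> D \<and> i \<le> H then h j i else 0)"
  by (auto simp: form_of_def coeff_sum)

text \<open>The bound \<open>m + b < CARD('p)\<close> keeps every binomial coefficient that occurs,
  including \<open>m + b choose m\<close>, invertible modulo the prime.\<close>

locale hyp_mod =
  fixes m b :: nat and f g :: "'p::prime_card mod_ring poly"
  assumes f_eq: "f = hyp_poly m b" and g_eq: "g = [:0, 1:] * pderiv f"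
    and m_pos: "0 < m" and m_le_b: "m \<le> b" and sum_less: "m + b < CARD('p)"
begin

lemma of_nat_eq_0_iff: "(of_nat n :: 'p mod_ring) = 0 \<longleftrightarrow> CARD('p) dvd n"
  by (metis of_nat_0_mod_ring_dvd dvdE mult_zero_left of_nat_card_eq_0 of_nat_mult)

lemma of_nat_fact_nonzero: "n < CARD('p) \<Longrightarrow> (of_nat (fact n) :: 'p mod_ring) \<noteq> 0"
  using prime_dvd_fact_iff[OF prime_card[where ?'a = 'p], of n] by (simp add: of_nat_eq_0_iff del: of_nat_fact)

lemma of_nat_choose_nonzero:
  assumes "k \<le> n" "n < CARD('p)"
  shows "(of_nat (n choose k) :: 'p mod_ring) \<noteq> 0"
proof
  assume "(of_nat (n choose k) :: 'p mod_ring) = 0"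
  hence "CARD('p) dvd (n choose k)" by (simp add: of_nat_eq_0_iff)
  hence "CARD('p) dvd fact n" using binomial_fact_lemma[OF assms(1)] by (metis dvd_mult)
  thus False using assms(2) prime_dvd_fact_iff[OF prime_card[where ?'a = 'p], of n] by simp
qed

lemma coeff_f_0: "coeff f 0 = 1"
  by (simp add: f_eq coeff_hyp_poly)

lemma coeff_f_m: "coeff f m \<noteq> 0"
  using of_nat_choose_nonzero[of m b] m_le_b sum_less by (simp add: f_eq coeff_hyp_poly)

lemma degree_f: "degree f = m"
proof (rule antisym)
  show "degree f \<le> m"
    by (rule degree_le) (auto simp: f_eq coeff_hyp_poly binomial_eq_0)
  show "m \<le> degree f" using coeff_f_m by (rule le_degree)
qed

lemma f_nonzero: "f \<noteq> 0"
  using coeff_f_0 by auto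

lemma degree_g_le: "degree g \<le> m"
proof (rule degree_le, intro allI impI)
  fix i assume "m < i"
  thus "coeff g i = 0"
    by (cases i) (auto simp: g_eq coeff_pderiv coeff_eq_0 degree_f)
qed

text \<open>By Vandermonde's identity the value is \<open>b + m choose m\<close>. The point 1 has to
  be excluded as a root because \<open>euler_deriv\<close> degenerates there.\<close>

lemma poly_f_1: "poly f 1 \<noteq> 0"
proof -
  have "poly f 1 = of_nat (\<Sum>n\<le>m. (m choose n) * (b choose n))"
    by (simp add: f_eq hyp_poly_def poly_sum poly_monom)
  also have "(\<Sum>n\<le>m. (m choose n) * (b choose n)) = (\<Sum>n\<le>m. (b choose n) * (m choose (m - n)))"
    by (intro sum.cong refl) (simp add: binomial_symmetric[symmetric] mult.commute)
  also have "\<dots> = (b + m choose m)" by (rule vandermonde)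
  finally show ?thesis
    using of_nat_choose_nonzero[of m "b + m"] sum_less by simp
qed

abbreviation zp :: "'p mod_ring poly" where "zp \<equiv> monom 1 (Suc 0)"
definition yp :: "'p mod_ring poly" where "yp = [:1, -1:]"
definition cp :: "'p mod_ring poly" where "cp = of_nat (m * b)"
definition ep :: "'p mod_ring poly" where "ep = of_nat (m + b)"

lemma euler_deriv_eq: "euler_deriv q = yp * (zp * pderiv q)" for q :: "'p mod_ring poly"
  by (simp add: euler_deriv_def yp_def monom_altdef mult.assoc[symmetric])

lemma euler_deriv_f: "euler_deriv f = yp * g"
  by (simp add: euler_deriv_eq g_eq monom_altdef)

lemma euler_deriv_g: "euler_deriv g = zp * (cp * f - ep * g)"
  using hyp_poly_ode[where ?'a = "'p mod_ring", of m b]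
  by (simp add: f_eq[symmetric] g_eq[symmetric] cp_def ep_def monom_altdef del: mult_pCons_left)

text \<open>If \<open>f\<close> and \<open>g\<close> both vanish at \<open>a\<close>, so do all
  iterates of \<open>euler_deriv\<close> on \<open>f\<close>, since the differential equation writes
  them as combinations of \<open>f\<close> and \<open>g\<close>. Then \<open>f\<close> is divisible
  by a power exceeding its degree.\<close>

lemma g_nonzero_at_root:
  assumes "poly f a = 0"
  shows "a \<noteq> 0" "a \<noteq> 1" "poly g a \<noteq> 0"
proof -
  show a0: "a \<noteq> 0" using assms coeff_f_0 by (auto simp: poly_0_coeff_0)
  show a1: "a \<noteq> 1" using assms poly_f_1 by auto
  show "poly g a \<noteq> 0"
  proof
    assume ga: "poly g a = 0"
    have "\<exists>u v. (euler_deriv ^^ n) f = u * f + v * g" for n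
    proof (induction n)
      case 0
      have "(euler_deriv ^^ 0) f = 1 * f + 0 * g" by simp
      thus ?case by blast
    next
      case (Suc n)
      then obtain u v where "(euler_deriv ^^ n) f = u * f + v * g" by blast
      hence "(euler_deriv ^^ Suc n) f = (euler_deriv u + v * zp * cp) * f + (u * yp + euler_deriv v - v * zp * ep) * g"
        by (simp add: euler_deriv_add euler_deriv_mult euler_deriv_f euler_deriv_g algebra_simps)
      thus ?case by blast
    qed
    hence "poly ((euler_deriv ^^ n) f) a = 0" for n
      by (metis assms ga mult_zero_right poly_add poly_mult add_0)
    hence "[:- a, 1:] ^ Suc m dvd f"
      using a0 a1 of_nat_fact_nonzero sum_less by (intro power_dvd_of_euler_deriv_iterates) auto
    hence "degree ([:- a, 1:] ^ Suc m) \<le> degree f"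
      using f_nonzero by (rule dvd_imp_degree_le)
    thus False by (simp add: degree_linear_power degree_f del: power_Suc)
  qed
qed

lemma order_f_root:
  assumes "poly f a = 0"
  shows "order a f = 1"
proof -
  have "order a f \<noteq> 0" using assms f_nonzero by (simp add: order_root)
  moreover have "\<not> order a f \<ge> 2"
  proof
    assume "order a f \<ge> 2"
    hence "[:- a, 1:] ^ 2 dvd f" by (simp add: order_divides)
    then obtain r where "f = [:- a, 1:] * ([:- a, 1:] * r)"
      by (auto simp only: power2_eq_square mult.assoc elim!: dvdE)
    hence "pderiv f = [:- a, 1:] * pderiv ([:- a, 1:] * r) + [:- a, 1:] * r * pderiv [:- a, 1:]"
      by (simp only: pderiv_mult)
    hence "poly (pderiv f) a = 0" by simp
    hence "poly g a = 0" by (simp add: g_eq)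
    thus False using g_nonzero_at_root(3)[OF assms] by simp
  qed
  ultimately show ?thesis by linarith
qed

lemma card_roots_f:
  assumes "size (proots f) = degree f"
  shows "card {a. poly f a = 0} = m"
proof -
  have "size (proots f) = (\<Sum>a\<in>set_mset (proots f). count (proots f) a)"
    by (rule size_multiset_overloaded_eq)
  also have "\<dots> = (\<Sum>a | poly f a = 0. order a f)" using f_nonzero by simp
  also have "\<dots> = (\<Sum>a | poly f a = 0. 1)" by (intro sum.cong refl) (simp add: order_f_root)
  finally show ?thesis using assms by (simp add: degree_f)
qed

text \<open>
  A polynomial \<open>A\<close> in \<open>S = g / f\<close> of degree at most \<open>D\<close> stands for the form
  \<open>\<Sum> A\<^sub>j f\<^sup>D\<^sup>-\<^sup>j g\<^sup>j\<close>; \<open>form_deriv D\<close> is the derivation \<open>z (1 - z) d/dz\<close> of such forms.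
\<close>

definition form_value :: "nat \<Rightarrow> 'p mod_ring poly poly \<Rightarrow> 'p mod_ring poly" where
  "form_value D A = (\<Sum>j\<le>D. coeff A j * f ^ (D - j) * g ^ j)"

definition form_deriv :: "nat \<Rightarrow> 'p mod_ring poly poly \<Rightarrow> 'p mod_ring poly poly" where
  "form_deriv D A = map_poly euler_deriv A + [:zp * cp, - (zp * ep), - yp:] * pderiv A
     + smult (of_nat D * yp) (pCons 0 A)"

lemma coeff_form_deriv:
  "coeff (form_deriv D A) j = euler_deriv (coeff A j) + of_nat (Suc j) * zp * cp * coeff A (Suc j)
     - of_nat j * zp * ep * coeff A j
     + (case j of 0 \<Rightarrow> 0 | Suc i \<Rightarrow> (of_nat D - of_nat i) * yp * coeff A i)"
  by (auto simp: form_deriv_def coeff_map_poly coeff_pderiv coeff_pCons algebra_simps split: nat.split)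

lemma form_value_diff: "form_value D (A - B) = form_value D A - form_value D B"
  by (simp add: form_value_def sum_subtractf algebra_simps)

lemma form_value_smult: "form_value D (smult c A) = c * form_value D A"
  by (simp add: form_value_def sum_distrib_left algebra_simps)

lemma form_value_form_deriv:
  assumes "degree A \<le> D"
  shows "euler_deriv (form_value D A) = form_value D (form_deriv D A)"
proof -
  \<comment> \<open>\<open>T\<close>, \<open>Y\<close>, \<open>X\<close>, \<open>W\<close> come from
    differentiating the coefficient, the power of \<open>f\<close>, and, in the power of
    \<open>g\<close>, from the \<open>f\<close> part and the \<open>g\<close> part of the derivative
    of \<open>g\<close>. \<open>Y\<close> raises the exponent of \<open>g\<close> by one and
    \<open>X\<close> lowers it, whence the index shifts below.\<close>
  define T where "T = (\<lambda>j. euler_deriv (coeff A j) * f ^ (D - j) * g ^ j)"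
  define Y where "Y = (\<lambda>j. of_nat (D - j) * yp * coeff A j * f ^ (D - Suc j) * g ^ Suc j)"
  define X where "X = (\<lambda>j. of_nat j * zp * cp * coeff A j * f ^ (Suc D - j) * g ^ (j - 1))"
  define W where "W = (\<lambda>j. of_nat j * zp * ep * coeff A j * f ^ (D - j) * g ^ j)"
  have 1: "euler_deriv (coeff A j * f ^ (D - j) * g ^ j) = T j + Y j + X j - W j" if "j \<le> D" for j
  proof -
    have eq: "euler_deriv (coeff A j * f ^ (D - j) * g ^ j) = euler_deriv (coeff A j) * f ^ (D - j) * g ^ j
        + coeff A j * (of_nat (D - j) * f ^ (D - j - 1) * (yp * g)) * g ^ j
        + coeff A j * f ^ (D - j) * (of_nat j * g ^ (j - 1) * (zp * (cp * f - ep * g)))"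
      by (simp only: euler_deriv_mult euler_deriv_power euler_deriv_f euler_deriv_g distrib_right)
    show ?thesis
    proof (cases j)
      case 0
      then show ?thesis
        unfolding eq by (simp add: T_def Y_def X_def W_def algebra_simps)
    next
      case (Suc i)
      hence "Suc D - j = Suc (D - j)" using that by simp
      with Suc show ?thesis
        unfolding eq by (simp add: T_def Y_def X_def W_def algebra_simps)
    qed
  qed
  have 2: "coeff (form_deriv D A) j * f ^ (D - j) * g ^ j =
      T j + X (Suc j) - W j + (case j of 0 \<Rightarrow> 0 | Suc i \<Rightarrow> Y i)" if "j \<le> D" for j
    using that
    by (auto simp: coeff_form_deriv T_def Y_def X_def W_def algebra_simps of_nat_diff split: nat.split)
  have "(\<Sum>j\<le>D. case j of 0 \<Rightarrow> 0 | Suc i \<Rightarrow> Y i) = (\<Sum>j<D. Y j)"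
    by (simp add: lessThan_Suc_atMost[symmetric] sum.lessThan_Suc_shift del: sum.lessThan_Suc)
  also have "\<dots> = (\<Sum>j\<le>D. Y j)"
    by (simp add: lessThan_Suc_atMost[symmetric] Y_def)
  finally have 3: "(\<Sum>j\<le>D. case j of 0 \<Rightarrow> 0 | Suc i \<Rightarrow> Y i) = (\<Sum>j\<le>D. Y j)" .
  have "(\<Sum>j\<le>D. X (Suc j)) + X 0 = (\<Sum>j\<le>Suc D. X j)"
    by (simp only: sum.atMost_Suc_shift add.commute)
  hence 4: "(\<Sum>j\<le>D. X (Suc j)) = (\<Sum>j\<le>D. X j)"
    using assms by (simp add: X_def coeff_eq_0)
  have "euler_deriv (form_value D A) = (\<Sum>j\<le>D. T j + Y j + X j - W j)"
    by (simp add: form_value_def euler_deriv_sum 1)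
  also have "\<dots> = (\<Sum>j\<le>D. T j + X (Suc j) - W j + (case j of 0 \<Rightarrow> 0 | Suc i \<Rightarrow> Y i))"
    by (simp only: sum.distrib sum_subtractf 3 4) simp
  also have "\<dots> = form_value D (form_deriv D A)"
    unfolding form_value_def by (intro sum.cong refl) (simp add: 2)
  finally show ?thesis .
qed

end

section \<open>Stepanov's auxiliary polynomial: existence and vanishing\<close>

lemma fermat_mod_ring:
  fixes a :: "'p::prime_card mod_ring"
  assumes "a \<noteq> 0"
  shows "a ^ (CARD('p) - 1) = 1"
proof -
  obtain i where i: "a = of_nat i" using surj_of_nat_mod_ring by blast
  have "\<not> CARD('p) dvd i" using assms unfolding i
    by (metis dvdE mult_zero_left of_nat_card_eq_0 of_nat_mult)
  hence "[i ^ (CARD('p) - 1) = 1] (mod CARD('p))"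
    using fermat_theorem[OF prime_card] by blast
  hence "(of_nat (i ^ (CARD('p) - 1)) :: 'p mod_ring) = of_nat 1"
    by (metis cong_def of_nat_mod_CHAR semiring_char_mod_ring)
  thus ?thesis by (simp add: i)
qed

context hyp_mod
begin

definition coeff_degrees_le :: "nat \<Rightarrow> 'p mod_ring poly poly \<Rightarrow> bool" where
  "coeff_degrees_le H A \<longleftrightarrow> (\<forall>j. degree (coeff A j) \<le> H)"

text \<open>The derivation on the cofactor of z^(p-1): z d/dz multiplies that power by p - 1 = -1,
  and the factor \<open>1 - z\<close> turns this into the term \<open>- yp\<close>.\<close>

definition form_deriv_twisted :: "nat \<Rightarrow> 'p mod_ring poly poly \<Rightarrow> 'p mod_ring poly poly" where
  "form_deriv_twisted D B = form_deriv D B - smult yp B"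

text \<open>The possible term of degree \<open>D + 1\<close> has the factor \<open>D - D\<close>:
  the derivative of \<open>f ^ D\<close> cancels the quadratic term of the Riccati equation.\<close>

lemma degree_form_deriv_le:
  assumes "degree A \<le> D"
  shows "degree (form_deriv D A) \<le> D"
proof (rule degree_le, intro allI impI)
  fix i assume i: "D < i"
  then obtain k where k: "i = Suc k" "D \<le> k" by (cases i) auto
  show "coeff (form_deriv D A) i = 0"
    using assms k by (cases "k = D") (auto simp: coeff_form_deriv coeff_eq_0)
qed

lemma degree_form_deriv_twisted_le: "degree B \<le> D \<Longrightarrow> degree (form_deriv_twisted D B) \<le> D"
  unfolding form_deriv_twisted_def
  by (intro degree_diff_le degree_form_deriv_le) (auto intro: order.trans[OF degree_smult_le])

lemma degree_yp_mult_le: "degree (yp * q) \<le> Suc (degree q)"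
  using degree_mult_le[of yp q] by (simp add: yp_def)

lemma degree_zp_mult_le: "degree (of_nat k * zp * of_nat l * q) \<le> Suc (degree q)"
proof -
  have "of_nat k * zp * of_nat l * q = smult (of_nat (k * l)) (pCons 0 q)"
    by (simp add: monom_altdef of_nat_poly mult.commute)
  thus ?thesis by (metis degree_pCons_le degree_smult_le order.trans)
qed

lemma coeff_degrees_le_form_deriv: "coeff_degrees_le H A \<Longrightarrow> coeff_degrees_le (Suc H) (form_deriv D A)"
  unfolding coeff_degrees_le_def
proof
  fix j assume H: "\<forall>j. degree (coeff A j) \<le> H"
  have 1: "degree (euler_deriv (coeff A j)) \<le> Suc H"
    using degree_euler_deriv_le[of "coeff A j"] H[rule_format, of j] by simp
  have 2: "degree (of_nat (Suc j) * zp * cp * coeff A (Suc j)) \<le> Suc H"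
    unfolding cp_def using degree_zp_mult_le H by (meson Suc_le_mono order.trans)
  have 3: "degree (of_nat j * zp * ep * coeff A j) \<le> Suc H"
    unfolding ep_def using degree_zp_mult_le H by (meson Suc_le_mono order.trans)
  have 4: "degree ((of_nat D - of_nat i) * yp * coeff A i) \<le> Suc H" for i
  proof -
    have "(of_nat D - of_nat i) * yp * coeff A i = smult (of_nat D - of_nat i) (yp * coeff A i)"
      by (simp add: of_nat_poly mult.assoc smult_diff_left left_diff_distrib)
    also have "degree \<dots> \<le> degree (yp * coeff A i)" by (rule degree_smult_le)
    also have "\<dots> \<le> Suc H" using degree_yp_mult_le H by (meson Suc_le_mono order.trans)
    finally show ?thesis .
  qed
  show "degree (coeff (form_deriv D A) j) \<le> Suc H"
    unfolding coeff_form_deriv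
    by (intro degree_add_le degree_diff_le 1 2 3) (auto split: nat.split intro: 4)
qed

lemma coeff_degrees_le_form_deriv_twisted: "coeff_degrees_le H B \<Longrightarrow> coeff_degrees_le (Suc H) (form_deriv_twisted D B)"
  using coeff_degrees_le_form_deriv[of H B D] degree_yp_mult_le
  unfolding coeff_degrees_le_def form_deriv_twisted_def by (auto intro!: degree_diff_le) (meson Suc_le_mono order.trans)

lemma form_deriv_diff: "form_deriv D (A - B) = form_deriv D A - form_deriv D B"
  by (rule poly_eqI) (simp add: coeff_form_deriv euler_deriv_diff algebra_simps split: nat.split)

lemma form_deriv_twisted_diff: "form_deriv_twisted D (A - B) = form_deriv_twisted D A - form_deriv_twisted D B"
  by (simp add: form_deriv_twisted_def form_deriv_diff smult_diff_right)

text \<open>The two forms have \<open>2 * (D + 1) * (H + 1)\<close> coefficients in all. Each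
  derivation raises the degree in \<open>z\<close> by at most one, so the n-th condition amounts to
  \<open>H + n + 1\<close> linear equations.\<close>

lemma exists_forms:
  assumes count: "(\<Sum>n<M. H + n + 1) < 2 * (D + 1) * (H + 1)"
  obtains A B where "A \<noteq> 0 \<or> B \<noteq> 0" "degree A \<le> D" "degree B \<le> D" "coeff_degrees_le H A" "coeff_degrees_le H B"
    and "\<And>n. n < M \<Longrightarrow> coeff ((form_deriv D ^^ n) A) D + coeff ((form_deriv_twisted D ^^ n) B) D = 0"
proof -
  define I where "I = {..D} \<times> {..H} \<times> (UNIV :: bool set)"
  define J where "J = Sigma {..<M} (\<lambda>n. {..H + n})"
  define F where "F = (\<lambda>t (h :: nat \<times> nat \<times> bool \<Rightarrow> 'p mod_ring). form_of D H (\<lambda>j i. h (j, i, t)))"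
  define L where "L = (\<lambda>(n, i) h. coeff (coeff ((form_deriv D ^^ n) (F True h)) D
      + coeff ((form_deriv_twisted D ^^ n) (F False h)) D) i)"
  have F_diff: "F t (\<lambda>x. h x - h' x) = F t h - F t h'" for t h h'
    unfolding F_def by (intro poly_eqI) (simp add: coeff_form_of)
  have iter: "(form_deriv D ^^ n) (A - B) = (form_deriv D ^^ n) A - (form_deriv D ^^ n) B"
    "(form_deriv_twisted D ^^ n) (A - B) = (form_deriv_twisted D ^^ n) A - (form_deriv_twisted D ^^ n) B" for n A B
    by (induction n) (simp_all add: form_deriv_diff form_deriv_twisted_diff)
  have "L j (\<lambda>x. h x - h' x) = L j h - L j h'" for j h h'
    by (cases j) (simp add: L_def F_diff iter)
  moreover have "card J < card I"
    using count by (simp add: I_def J_def card_UNIV_bool)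
  moreover have "finite I" "finite J" by (auto simp: I_def J_def)
  ultimately obtain h where h: "\<exists>x\<in>I. h x \<noteq> 0" "\<And>j. j \<in> J \<Longrightarrow> L j h = 0"
    using nontrivial_common_zero[of I J L] by metis
  have deg: "degree (F t h) \<le> D" for t
    by (rule degree_le) (auto simp: F_def poly_eq_iff coeff_form_of)
  have coeff_degrees_le: "coeff_degrees_le H (F t h)" for t
    unfolding coeff_degrees_le_def by (intro allI degree_le) (auto simp: F_def coeff_form_of)
  have coeff_degrees_le_iter: "coeff_degrees_le (H + n) ((form_deriv D ^^ n) (F True h))" "coeff_degrees_le (H + n) ((form_deriv_twisted D ^^ n) (F False h))" for n
    by (induction n) (simp_all add: coeff_degrees_le coeff_degrees_le_form_deriv coeff_degrees_le_form_deriv_twisted)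
  obtain j i t where "(j, i, t) \<in> I" "h (j, i, t) \<noteq> 0" using h(1) by auto
  hence "coeff (coeff (F t h) j) i \<noteq> 0" by (simp add: F_def coeff_form_of I_def)
  hence "F t h \<noteq> 0" by auto
  hence nz: "F True h \<noteq> 0 \<or> F False h \<noteq> 0" by (cases t) auto
  have "coeff ((form_deriv D ^^ n) (F True h)) D + coeff ((form_deriv_twisted D ^^ n) (F False h)) D = 0" (is "?q = 0")
    if "n < M" for n
  proof (rule poly_eqI)
    fix i
    have "degree ?q \<le> H + n"
      using coeff_degrees_le_iter[of n] unfolding coeff_degrees_le_def by (intro degree_add_le) auto
    hence "coeff ?q i = 0" if "\<not> i \<le> H + n" using that by (intro coeff_eq_0) simp
    thus "coeff ?q i = coeff 0 i"
      using h(2)[of "(n, i)"] \<open>n < M\<close> by (cases "i \<le> H + n") (auto simp: J_def L_def)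
  qed
  with nz deg coeff_degrees_le show ?thesis using that by blast
qed

definition Ep :: "'p mod_ring poly" where "Ep = monom 1 (CARD('p) - 1)"

lemma card_gt_1: "CARD('p) > 1"
  using prime_card[where ?'a = 'p] by (rule prime_gt_1_nat)

lemma euler_deriv_Ep: "euler_deriv Ep = - (yp * Ep)"
proof -
  have "of_nat (CARD('p) - 1) = (- 1 :: 'p mod_ring)"
    using card_gt_1 by (simp add: of_nat_diff)
  hence "zp * pderiv Ep = - Ep"
    using card_gt_1 by (simp add: Ep_def pderiv_monom mult_monom minus_monom Suc_diff_Suc)
  thus ?thesis by (simp add: euler_deriv_eq)
qed

lemma form_value_form_deriv_twisted: "form_value D (form_deriv_twisted D B) = form_value D (form_deriv D B) - yp * form_value D B"
  by (simp add: form_deriv_twisted_def form_value_diff form_value_smult)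

lemma euler_deriv_iterate_form:
  assumes "degree A \<le> D" "degree B \<le> D"
  shows "(euler_deriv ^^ n) (form_value D A + Ep * form_value D B) =
      form_value D ((form_deriv D ^^ n) A) + Ep * form_value D ((form_deriv_twisted D ^^ n) B)"
proof -
  have deg: "degree ((form_deriv D ^^ n) A) \<le> D" "degree ((form_deriv_twisted D ^^ n) B) \<le> D" for n
    using assms by (induction n) (simp_all add: degree_form_deriv_le degree_form_deriv_twisted_le)
  show ?thesis
  proof (induction n)
    case (Suc n)
    show ?case
      using deg[of n]
      by (simp add: Suc euler_deriv_add euler_deriv_mult form_value_form_deriv euler_deriv_Ep form_value_form_deriv_twisted algebra_simps)
  qed simp
qed

lemma poly_form_value_root:
  assumes "poly f a = 0"
  shows "poly (form_value D A) a = poly (coeff A D) a * poly g a ^ D"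
proof -
  have "poly (form_value D A) a = (\<Sum>j\<le>D. if j = D then poly (coeff A D) a * poly g a ^ D else 0)"
    unfolding form_value_def poly_sum using assms by (intro sum.cong) (auto simp: poly_power power_0_left)
  thus ?thesis by simp
qed

lemma degree_form_value_le:
  assumes "coeff_degrees_le H A"
  shows "degree (form_value D A) \<le> H + D * m"
  unfolding form_value_def
proof (rule degree_sum_le)
  fix j assume "j \<in> {..D}"
  have "degree (coeff A j * f ^ (D - j) * g ^ j) \<le> degree (coeff A j) + degree (f ^ (D - j)) + degree (g ^ j)"
    by (meson add_mono degree_mult_le order.refl order.trans)
  also have "\<dots> \<le> H + m * (D - j) + m * j"
    using assms degree_power_le[of f "D - j"]
      order.trans[OF degree_power_le[of g j] mult_le_mono1[OF degree_g_le]]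
    by (intro add_mono) (auto simp: coeff_degrees_le_def degree_f)
  also have "m * (D - j) + m * j = m * D" using \<open>j \<in> {..D}\<close>
    by (simp flip: distrib_left)
  hence "H + m * (D - j) + m * j = H + D * m" by (simp add: mult.commute)
  finally show "degree (coeff A j * f ^ (D - j) * g ^ j) \<le> H + D * m" .
qed simp

lemma auxiliary_poly_eq_0:
  assumes split: "size (proots f) = degree f"
    and deg: "degree A \<le> D" "degree B \<le> D" and coeff_degrees_le: "coeff_degrees_le H A" "coeff_degrees_le H B"
    and van: "\<And>n. n < M \<Longrightarrow> coeff ((form_deriv D ^^ n) A) D + coeff ((form_deriv_twisted D ^^ n) B) D = 0"
    and M: "M \<le> CARD('p)" "H + D * m + (CARD('p) - 1) < M * m"
  shows "form_value D A + Ep * form_value D B = 0"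
proof (rule ccontr)
  define \<Phi> where "\<Phi> = form_value D A + Ep * form_value D B"
  assume "form_value D A + Ep * form_value D B \<noteq> 0"
  hence nz: "\<Phi> \<noteq> 0" by (simp add: \<Phi>_def)
  have M0: "M > 0" using M by (cases M) auto
  have ord: "M \<le> order a \<Phi>" if a: "poly f a = 0" for a
  proof -
    note a' = g_nonzero_at_root[OF a]
    have "a ^ (CARD('p) - 1) = 1"
      using a'(1) by (rule fermat_mod_ring)
    hence E: "poly Ep a = 1" by (simp add: Ep_def poly_monom)
    have "poly ((euler_deriv ^^ n) \<Phi>) a = 0" if "n < M" for n
    proof -
      \<comment> \<open>At the root only the terms with the full power of \<open>g\<close> survive,
        and \<open>poly Ep a = 1\<close> merges the two forms into the polynomial that is zero by
        \<open>van\<close>.\<close>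
      have "poly ((euler_deriv ^^ n) \<Phi>) a =
        poly (coeff ((form_deriv D ^^ n) A) D + coeff ((form_deriv_twisted D ^^ n) B) D) a * poly g a ^ D"
        unfolding \<Phi>_def euler_deriv_iterate_form[OF deg] by (simp add: poly_form_value_root[OF a] E algebra_simps)
      thus ?thesis using van[OF that] by simp
    qed
    hence "[:- a, 1:] ^ M dvd \<Phi>"
      using a' M(1) of_nat_fact_nonzero by (intro power_dvd_of_euler_deriv_iterates) auto
    thus ?thesis using nz by (simp add: order_divides)
  qed
  \<comment> \<open>There are \<open>m\<close> distinct roots, each of order at least
    \<open>M\<close> in \<open>\<Phi>\<close>; this total exceeds the degree.\<close>
  have "M * m = (\<Sum>a | poly f a = 0. M)" using card_roots_f[OF split] by simp
  also have "\<dots> \<le> (\<Sum>a | poly f a = 0. order a \<Phi>)" by (intro sum_mono) (simp add: ord)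
  also have "\<dots> \<le> (\<Sum>a | poly \<Phi> a = 0. order a \<Phi>)"
  proof (rule sum_mono2)
    show "{a. poly f a = 0} \<subseteq> {a. poly \<Phi> a = 0}"
      using ord M0 order_root[of \<Phi>] by fastforce
  qed (use nz in \<open>auto simp: poly_roots_finite\<close>)
  also have "\<dots> \<le> degree \<Phi>" using nz by (rule sum_order_le_degree)
  also have "\<dots> \<le> H + D * m + (CARD('p) - 1)"
    unfolding \<Phi>_def
  proof (rule degree_add_le)
    show "degree (form_value D A) \<le> H + D * m + (CARD('p) - 1)"
      using degree_form_value_le[OF coeff_degrees_le(1), of D] by (rule trans_le_add1)
    show "degree (Ep * form_value D B) \<le> H + D * m + (CARD('p) - 1)"
      using degree_form_value_le[OF coeff_degrees_le(2), of D] degree_mult_le[of Ep "form_value D B"]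
        degree_monom_le[of "1 :: 'p mod_ring" "CARD('p) - 1"] unfolding Ep_def by linarith
  qed
  finally show False using M(2) by simp
qed

end

section \<open>The auxiliary polynomial does not vanish identically\<close>

lemma size_proots_dvd:
  fixes f :: "'p::prime_card mod_ring poly"
  assumes "size (proots f) = degree f" "f \<noteq> 0" "q dvd f"
  shows "size (proots q) = degree q"
proof -
  obtain r where r: "f = q * r" using assms(3) by (elim dvdE)
  hence "q \<noteq> 0" "r \<noteq> 0" using assms(2) by auto
  hence "size (proots q) + size (proots r) = degree q + degree r"
    using assms(1) by (simp add: r proots_mult degree_mult_eq)
  thus ?thesis using size_proots_le[of q] size_proots_le[of r] by linarith
qed

context hyp_mod
begin

text \<open>A nonconstant common factor inherits the splitting from \<open>f\<close>, hence would
  supply a common root.\<close>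

lemma coprime_f_g:
  assumes split: "size (proots f) = degree f"
  shows "coprime f g"
proof (rule ccontr)
  assume "\<not> coprime f g"
  then obtain q where q: "q dvd f" "q dvd g" "\<not> is_unit q" by (auto simp: coprime_def)
  have "size (proots q) = degree q" using split f_nonzero q(1) by (rule size_proots_dvd)
  moreover have "degree q \<noteq> 0" using q f_nonzero
    by (metis dvd_0_left is_unit_iff_degree)
  ultimately have "proots q \<noteq> {#}" by auto
  then obtain a where "a \<in># proots q" by blast
  moreover have "q \<noteq> 0" using q(1) f_nonzero by auto
  ultimately have "poly q a = 0" by simp
  hence "poly f a = 0" "poly g a = 0" using q(1,2) by (auto elim!: dvdE)
  thus False using g_nonzero_at_root by blast
qed

text \<open>Modulo \<open>f\<close> only the top term \<open>coeff C N * g ^ N\<close> remains. By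
  coprimality \<open>f\<close> divides its coefficient, which is therefore zero for degree reasons;
  then \<open>f\<close> is cancelled and the argument repeats.\<close>

lemma form_value_eq_0_imp:
  assumes split: "size (proots f) = degree f"
    and "form_value N C = 0" "degree C \<le> N" "\<And>j. degree (coeff C j) < m"
  shows "C = 0"
  using assms(2-)
proof (induction N)
  case 0
  hence "coeff C 0 = 0" by (simp add: form_value_def)
  thus ?case using 0(2) by (metis leading_coeff_0_iff le_0_eq)
next
  case (Suc N)
  have top: "form_value (Suc N) C = f * form_value N C + coeff C (Suc N) * g ^ Suc N"
    unfolding form_value_def sum_distrib_left by (simp add: Suc_diff_le mult_ac)
  have "coeff C (Suc N) * g ^ Suc N = f * (- form_value N C)"
    using Suc.prems(1) unfolding top by (simp add: eq_neg_iff_add_eq_0 add.commute)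
  hence "f dvd coeff C (Suc N) * g ^ Suc N" by simp
  hence "f dvd coeff C (Suc N)"
    using coprime_f_g[OF split] coprime_dvd_mult_left_iff coprime_power_right_iff by metis
  hence top0: "coeff C (Suc N) = 0"
    using Suc.prems(3)[of "Suc N"] dvd_imp_degree_le degree_f by (metis leD)
  hence "form_value N C = 0" using Suc.prems(1) f_nonzero unfolding top by simp
  moreover have "degree C \<le> N"
    using Suc.prems(2) top0 by (metis le_Suc_eq leading_coeff_0_iff degree_0 le0)
  ultimately show ?case using Suc.IH Suc.prems(3) by blast
qed

text \<open>Laurent series are a field in which \<open>f\<close> and \<open>1 - z\<close> are
  invertible and in which the logarithmic singularity at 0 is visible as a constant
  coefficient.\<close>

definition \<iota> :: "'p mod_ring poly \<Rightarrow> 'p mod_ring fls" where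
  "\<iota> q = fps_to_fls (fps_of_poly q)"

lemma \<iota>_add: "\<iota> (p + q) = \<iota> p + \<iota> q"
  by (simp add: \<iota>_def fps_of_poly_add)

lemma \<iota>_0: "\<iota> 0 = 0" and \<iota>_1: "\<iota> 1 = 1"
  by (simp_all add: \<iota>_def)

lemma \<iota>_mult: "\<iota> (p * q) = \<iota> p * \<iota> q"
  by (simp add: \<iota>_def fps_of_poly_mult fls_times_fps_to_fls)

lemma \<iota>_diff: "\<iota> (p - q) = \<iota> p - \<iota> q" and \<iota>_uminus: "\<iota> (- p) = - \<iota> p"
  by (simp_all add: \<iota>_def fps_of_poly_diff fps_of_poly_uminus)

lemma \<iota>_power: "\<iota> (p ^ n) = \<iota> p ^ n"
  by (simp add: \<iota>_def fps_of_poly_power fps_to_fls_power)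

lemma \<iota>_of_nat: "\<iota> (of_nat n) = of_nat n"
  by (induction n) (simp_all add: \<iota>_0 \<iota>_1 \<iota>_add)

lemmas \<iota>_simps = \<iota>_add \<iota>_diff \<iota>_uminus \<iota>_mult \<iota>_0 \<iota>_1 \<iota>_power \<iota>_of_nat

lemma \<iota>_eq_iff: "\<iota> p = \<iota> q \<longleftrightarrow> p = q"
  by (simp add: \<iota>_def fps_of_poly_eq_iff)

lemma \<iota>_sum: "\<iota> (sum h A) = (\<Sum>x\<in>A. \<iota> (h x))"
  by (induction A rule: infinite_finite_induct) (simp_all add: \<iota>_simps)

lemma map_poly_\<iota>_linear:
  "map_poly \<iota> (A + B) = map_poly \<iota> A + map_poly \<iota> B"
  "map_poly \<iota> (A - B) = map_poly \<iota> A - map_poly \<iota> B"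
  "map_poly \<iota> (smult c A) = smult (\<iota> c) (map_poly \<iota> A)"
  by (rule poly_eqI; simp add: coeff_map_poly \<iota>_simps)+

lemma map_poly_\<iota>_mult: "map_poly \<iota> (A * B) = map_poly \<iota> A * map_poly \<iota> B"
  by (rule poly_eqI) (simp add: coeff_map_poly \<iota>_simps coeff_mult \<iota>_sum)

lemma map_poly_\<iota>_pCons_pderiv:
  "map_poly \<iota> (pCons c A) = pCons (\<iota> c) (map_poly \<iota> A)"
  "map_poly \<iota> (pderiv A) = pderiv (map_poly \<iota> A)"
  by (rule poly_eqI; simp add: coeff_map_poly \<iota>_simps coeff_pderiv coeff_pCons split: nat.split)+

lemmas map_poly_\<iota>_simps = map_poly_\<iota>_linear map_poly_\<iota>_mult map_poly_\<iota>_pCons_pderiv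

definition \<theta> :: "'p mod_ring fls \<Rightarrow> 'p mod_ring fls" where
  "\<theta> x = fls_X * fls_deriv x"

sublocale \<theta>: derivation \<theta>
  by standard (simp_all add: \<theta>_def algebra_simps)

lemma \<iota>_zp: "\<iota> zp = fls_X"
  by (simp add: \<iota>_def fps_of_poly_monom fps_to_fls_power)

lemma \<iota>_pderiv: "\<iota> (zp * pderiv q) = \<theta> (\<iota> q)"
  unfolding \<iota>_mult \<iota>_zp \<theta>_def by (simp add: \<iota>_def fps_of_poly_pderiv fls_deriv_fps_to_fls)

lemma \<iota>_euler_deriv: "\<iota> (euler_deriv q) = \<iota> yp * \<theta> (\<iota> q)"
  by (simp only: euler_deriv_eq \<iota>_simps \<iota>_pderiv[unfolded \<iota>_simps])

lemma \<iota>_yp_nonzero: "\<iota> yp \<noteq> 0"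
  using \<iota>_eq_iff[of yp 0] by (simp add: yp_def \<iota>_simps)

lemma \<iota>_f_nonzero: "\<iota> f \<noteq> 0"
  using \<iota>_eq_iff[of f 0] f_nonzero by (simp add: \<iota>_simps)

definition log_deriv :: "'p mod_ring fls" where "log_deriv = \<iota> g / \<iota> f"
text \<open>The numerator satisfies the Wronskian equation of the differential equation. So
  \<open>kappa\<close> is formally \<open>\<theta>\<close> applied to the quotient of a second
  solution by \<open>f\<close>, and its constant term is the coefficient of log z in that
  quotient.\<close>

definition kappa :: "'p mod_ring fls" where "kappa = \<iota> yp ^ (m + b) / (\<iota> f)\<^sup>2"
definition riccati0 :: "'p mod_ring fls" where "riccati0 = fls_X * \<iota> cp / \<iota> yp"
definition riccati1 :: "'p mod_ring fls" where "riccati1 = - fls_X * \<iota> ep / \<iota> yp"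

lemma \<theta>_f: "\<theta> (\<iota> f) = \<iota> g"
  using \<iota>_pderiv[of f] by (simp add: g_eq monom_altdef)

lemma \<theta>_g: "\<theta> (\<iota> g) = riccati0 * \<iota> f + riccati1 * \<iota> g"
proof -
  have "\<iota> yp * \<theta> (\<iota> g) = fls_X * (\<iota> cp * \<iota> f - \<iota> ep * \<iota> g)"
    using \<iota>_euler_deriv[of g] unfolding euler_deriv_g by (simp add: \<iota>_simps \<iota>_zp)
  thus ?thesis using \<iota>_yp_nonzero by (simp add: riccati0_def riccati1_def field_simps)
qed

lemma \<theta>_log_deriv: "\<theta> log_deriv = riccati0 + riccati1 * log_deriv - log_deriv\<^sup>2"
  unfolding log_deriv_def \<theta>.D_divide[OF \<iota>_f_nonzero] \<theta>_f \<theta>_g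
  using \<iota>_f_nonzero by (simp add: field_simps power2_eq_square)

lemma \<theta>_power: "\<theta> (x ^ n) = of_nat n * x ^ (n - 1) * \<theta> x"
  by (simp add: \<theta>_def fls_deriv_power mult_ac)

lemma \<theta>_kappa: "\<theta> kappa = (riccati1 - 2 * log_deriv) * kappa"
proof -
  have y: "\<theta> (\<iota> yp) = - fls_X"
    using \<iota>_pderiv[of yp] by (simp add: yp_def pderiv_pCons \<iota>_simps \<iota>_zp)
  have W: "\<theta> (\<iota> yp ^ (m + b)) = riccati1 * \<iota> yp ^ (m + b)"
  proof -
    obtain k where "m + b = Suc k" using m_pos by (cases "m + b") auto
    moreover have "\<iota> ep = of_nat (m + b)" by (simp only: ep_def \<iota>_simps)
    ultimately show ?thesis
      unfolding \<theta>_power y riccati1_def using \<iota>_yp_nonzero by (simp add: field_simps del: of_nat_Suc of_nat_add)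
  qed
  have F: "\<theta> ((\<iota> f)\<^sup>2) = 2 * \<iota> f * \<iota> g"
    by (simp add: \<theta>_power \<theta>_f)
  have f2: "(\<iota> f)\<^sup>2 \<noteq> 0" using \<iota>_f_nonzero by simp
  show ?thesis
    unfolding kappa_def \<theta>.D_divide[OF f2] W F log_deriv_def
    using \<iota>_f_nonzero by (simp add: field_simps power2_eq_square)
qed

lemma kappa_nth_0: "fls_nth kappa 0 = 1"
proof -
  have f0: "fps_nth (fps_of_poly f) 0 \<noteq> 0" by (simp add: coeff_f_0)
  define k where "k = fps_of_poly yp ^ (m + b) * inverse (fps_of_poly f) ^ 2"
  have "k * fps_of_poly f ^ 2 = fps_of_poly yp ^ (m + b) * (inverse (fps_of_poly f) * fps_of_poly f) ^ 2"
    by (simp add: k_def power_mult_distrib)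
  also have "\<dots> = fps_of_poly yp ^ (m + b)" using f0 by (simp add: inverse_mult_eq_1)
  finally have "fps_to_fls k * (\<iota> f)\<^sup>2 = \<iota> yp ^ (m + b)"
    unfolding \<iota>_def by (metis fls_times_fps_to_fls fps_to_fls_power)
  hence "kappa = fps_to_fls k" using \<iota>_f_nonzero by (simp add: kappa_def field_simps)
  moreover have "fps_nth k 0 = 1"
    by (simp add: k_def fps_power_zeroth yp_def coeff_f_0)
  ultimately show ?thesis by simp
qed

text \<open>\<open>\<theta>\<close> multiplies the n-th coefficient by n, so
  \<open>\<theta> c\<close> has constant coefficient 0, whereas that of \<open>i * kappa\<close> is
  \<open>i\<close>. Hence the prime divides \<open>i\<close>, and the bound on \<open>D\<close>
  leaves only 0.\<close>

lemma kappa_not_derivative: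
  assumes "D < CARD('p)"
  shows "\<forall>c i. \<bar>i\<bar> \<le> int D \<longrightarrow> \<theta> c = of_int i * kappa \<longrightarrow> i = 0"
proof (intro allI impI)
  fix c i assume i: "\<bar>i\<bar> \<le> int D" and eq: "\<theta> c = of_int i * kappa"
  have "fls_nth (\<theta> c) 0 = 0" by (simp add: \<theta>_def fls_X_times_conv_shift)
  moreover have "fls_nth (of_int i * kappa) 0 = (of_int i :: 'p mod_ring)"
    by (simp add: fls_of_int[symmetric] kappa_nth_0)
  ultimately have 0: "(of_int i :: 'p mod_ring) = 0" using eq by metis
  have "(of_nat (nat \<bar>i\<bar>) :: 'p mod_ring) = of_int \<bar>i\<bar>" by simp
  also have "\<dots> = 0" using 0 by (cases "i \<ge> 0") auto
  finally have "CARD('p) dvd nat \<bar>i\<bar>" by (simp only: of_nat_eq_0_iff)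
  from dvd_imp_le[OF this] i assms show "i = 0" by (cases "i = 0") auto
qed

lemma \<iota>_form_value:
  assumes "degree A \<le> D"
  shows "\<iota> (form_value D A) = \<iota> f ^ D * poly (map_poly \<iota> A) log_deriv"
proof -
  have "degree (map_poly \<iota> A) \<le> D"
    using assms by (intro order.trans[OF degree_map_poly_le])
  hence "poly (map_poly \<iota> A) log_deriv = (\<Sum>j\<le>D. coeff (map_poly \<iota> A) j * log_deriv ^ j)"
    unfolding poly_altdef by (intro sum.mono_neutral_left) (auto simp: coeff_eq_0)
  also have "\<iota> f ^ D * \<dots> = (\<Sum>j\<le>D. \<iota> (coeff A j) * \<iota> f ^ (D - j) * \<iota> g ^ j)"
    unfolding sum_distrib_left
  proof (intro sum.cong refl)
    fix j assume "j \<in> {..D}"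
    hence "\<iota> f ^ D = \<iota> f ^ (D - j) * \<iota> f ^ j" by (simp flip: power_add)
    thus "\<iota> f ^ D * (coeff (map_poly \<iota> A) j * log_deriv ^ j) = \<iota> (coeff A j) * \<iota> f ^ (D - j) * \<iota> g ^ j"
      using \<iota>_f_nonzero by (simp add: log_deriv_def coeff_map_poly \<iota>_simps power_divide)
  qed
  finally show ?thesis by (simp add: form_value_def \<iota>_sum \<iota>_simps)
qed

lemma form_value_mult:
  assumes "degree A \<le> D" "degree B \<le> D'"
  shows "form_value D A * form_value D' B = form_value (D + D') (A * B)"
proof -
  have "degree (A * B) \<le> D + D'" using assms degree_mult_le[of A B] by linarith
  hence "\<iota> (form_value D A * form_value D' B) = \<iota> (form_value (D + D') (A * B))"
    using assms by (simp add: \<iota>_simps \<iota>_form_value map_poly_\<iota>_simps power_add mult_ac)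
  thus ?thesis by (simp add: \<iota>_eq_iff)
qed

lemma map_poly_\<iota>_form_deriv:
  "map_poly \<iota> (form_deriv D A) = smult (\<iota> yp) (map_poly \<theta> (map_poly \<iota> A)
     + [:riccati0, riccati1, -1:] * pderiv (map_poly \<iota> A) + smult (of_nat D) (pCons 0 (map_poly \<iota> A)))"
proof -
  have "map_poly \<iota> (map_poly euler_deriv A) = smult (\<iota> yp) (map_poly \<theta> (map_poly \<iota> A))"
    by (rule poly_eqI) (simp add: coeff_map_poly \<iota>_simps \<iota>_euler_deriv)
  moreover have "map_poly \<iota> [:zp * cp, - (zp * ep), - yp:] = smult (\<iota> yp) [:riccati0, riccati1, -1:]"
    using \<iota>_yp_nonzero by (simp add: map_poly_\<iota>_simps \<iota>_simps \<iota>_zp riccati0_def riccati1_def)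
  ultimately show ?thesis
    unfolding form_deriv_def
    by (simp only: map_poly_\<iota>_simps \<iota>_simps smult_add_right mult_smult_left mult_smult_right smult_smult mult.commute)
qed

text \<open>
  A form vanishing at \<open>(f, g)\<close> with small coefficients vanishes identically, so a relation
  \<open>form_value D A = - Ep * form_value D B\<close> and its derivative force the generic identity that \<open>A / B\<close> is an
  eigenfunction of the Riccati derivation; by the residue of \<open>kappa\<close> at the logarithmic singularity
  \<open>0\<close> this makes \<open>A / B\<close> a constant.
\<close>

lemma auxiliary_poly_nonzero:
  assumes split: "size (proots f) = degree f"
    and deg: "degree A \<le> D" "degree B \<le> D" and coeff_degrees_le: "coeff_degrees_le H A" "coeff_degrees_le H B"
    and nz: "A \<noteq> 0 \<or> B \<noteq> 0"
    and H: "2 * H + 1 < m" and D: "D < CARD('p)"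
  shows "form_value D A + Ep * form_value D B \<noteq> 0"
proof
  assume 0: "form_value D A + Ep * form_value D B = 0"
  have small: "degree (coeff A j) < m" "degree (coeff B j) < m" for j
    using coeff_degrees_le H unfolding coeff_degrees_le_def by (metis add_lessD1 le_less_trans mult_2 add.commute)+
  have B: "B \<noteq> 0"
  proof
    assume "B = 0"
    hence "form_value D A = 0" using 0 by (simp add: form_value_def)
    hence "A = 0" using form_value_eq_0_imp[OF split _ deg(1)] small by blast
    with \<open>B = 0\<close> nz show False by simp
  qed
  have a: "form_value D A = - (Ep * form_value D B)" using 0 by (simp add: eq_neg_iff_add_eq_0)
  have "euler_deriv (form_value D A + Ep * form_value D B) = 0" using 0 by simp
  hence a': "form_value D (form_deriv D A) = - (Ep * form_value D (form_deriv_twisted D B))"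
    using euler_deriv_iterate_form[OF deg, of 1] by (simp add: eq_neg_iff_add_eq_0)
  \<comment> \<open>The relation and its derivative relate both pairs of forms by the same factor
    \<open>- Ep\<close>. Eliminating it leaves a form with small coefficients, free of the high
    power of \<open>z\<close>.\<close>
  define C where "C = A * form_deriv_twisted D B - B * form_deriv D A"
  have "form_value (D + D) C = form_value D A * form_value D (form_deriv_twisted D B) - form_value D B * form_value D (form_deriv D A)"
    unfolding C_def form_value_diff by (simp add: form_value_mult deg degree_form_deriv_le degree_form_deriv_twisted_le)
  also have "\<dots> = 0" unfolding a a' by (simp add: mult_ac)
  finally have "form_value (D + D) C = 0" .
  moreover have "degree C \<le> D + D"
    unfolding C_def
    by (intro degree_diff_le order.trans[OF degree_mult_le] add_mono deg degree_form_deriv_le degree_form_deriv_twisted_le)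
  moreover have "degree (coeff C j) < m" for j
  proof -
    \<comment> \<open>One factor is a derivative and has coefficients of degree up to
      \<open>Suc H\<close>; this is the origin of \<open>2 * H + 1 < m\<close>.\<close>
    have prod: "degree (coeff (P * Q) j) \<le> H + Suc H" if "coeff_degrees_le H P" "coeff_degrees_le (Suc H) Q" for P Q
      unfolding coeff_mult
    proof (rule degree_sum_le)
      fix i
      show "degree (coeff P i * coeff Q (j - i)) \<le> H + Suc H"
        using that unfolding coeff_degrees_le_def by (meson add_mono degree_mult_le order.trans)
    qed simp
    have "degree (coeff C j) \<le> H + Suc H"
      unfolding C_def coeff_diff
      by (intro degree_diff_le prod coeff_degrees_le coeff_degrees_le_form_deriv coeff_degrees_le_form_deriv_twisted)
    thus ?thesis using H by simp
  qed
  ultimately have "C = 0" using form_value_eq_0_imp[OF split] by blast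
  hence eq: "map_poly \<iota> (A * form_deriv_twisted D B) = map_poly \<iota> (B * form_deriv D A)" by (simp add: C_def)
  let ?A = "map_poly \<iota> A" and ?B = "map_poly \<iota> B"
  define R where "R = [:riccati0, riccati1, -1:]"
  \<comment> \<open>The eigenvalue term \<open>smult 1\<close> is the \<open>- yp\<close> of the
    twisted derivation divided by \<open>yp\<close>.\<close>
  have scaled: "smult (\<iota> yp) (?A * (map_poly \<theta> ?B + R * pderiv ?B - smult 1 ?B)) =
      smult (\<iota> yp) (?B * (map_poly \<theta> ?A + R * pderiv ?A))"
    using eq unfolding form_deriv_twisted_def
    by (simp add: map_poly_\<iota>_simps map_poly_\<iota>_form_deriv R_def[symmetric])
       (simp add: algebra_simps smult_add_right smult_diff_right)
  have eq': "?A * (map_poly \<theta> ?B + R * pderiv ?B - smult 1 ?B) =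
      ?B * (map_poly \<theta> ?A + R * pderiv ?A)"
    using arg_cong[OF scaled, of "smult (inverse (\<iota> yp))"] \<iota>_yp_nonzero by simp
  have "?B \<noteq> 0"
  proof
    assume "?B = 0"
    hence "\<iota> (coeff B j) = \<iota> 0" for j by (metis coeff_0 coeff_map_poly \<iota>_0)
    thus False using B by (auto simp: \<iota>_eq_iff poly_eq_iff[of B])
  qed
  moreover have "degree ?A \<le> D" "degree ?B \<le> D"
    using deg by (auto intro: order.trans[OF degree_map_poly_le])
  moreover have "kappa \<noteq> 0" using kappa_nth_0 by auto
  ultimately obtain r where r: "?A = smult r ?B"
    using \<theta>.riccati_proportional_of_invariant_quotient[OF kappa_not_derivative[OF D] _ _ _ \<theta>_log_deriv \<theta>_kappa _
        eq'[unfolded R_def]] by blast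
  have "\<iota> (form_value D A) = r * \<iota> (form_value D B)" by (simp add: \<iota>_form_value deg r)
  hence neg: "- (\<iota> Ep * \<iota> (form_value D B)) = r * \<iota> (form_value D B)" by (simp add: a \<iota>_simps)
  have "(r + \<iota> Ep) * \<iota> (form_value D B) = 0" unfolding distrib_right neg[symmetric] by simp
  moreover have "\<iota> (form_value D B) \<noteq> 0"
    using form_value_eq_0_imp[OF split _ deg(2)] small B by (metis \<iota>_eq_iff \<iota>_0)
  ultimately have r': "r = - \<iota> Ep" by (simp add: eq_neg_iff_add_eq_0)
  \<comment> \<open>A nonzero coefficient of \<open>B\<close> would now force a coefficient of
    \<open>A\<close> of degree at least \<open>CARD('p) - 1\<close>, far above
    \<open>H\<close>.\<close>
  obtain j where j: "coeff B j \<noteq> 0" using B by (metis leading_coeff_0_iff)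
  have "coeff ?A j = r * coeff ?B j" by (simp add: r)
  hence "\<iota> (coeff A j) = \<iota> (- Ep * coeff B j)"
    by (simp add: coeff_map_poly \<iota>_simps r')
  hence "coeff A j = - Ep * coeff B j" by (simp add: \<iota>_eq_iff)
  hence "degree (coeff A j) = degree (Ep * coeff B j)" by simp
  also have "\<dots> = (CARD('p) - 1) + degree (coeff B j)"
    using j by (subst degree_mult_eq) (auto simp: Ep_def degree_monom_eq)
  finally have "CARD('p) - 1 \<le> degree (coeff A j)" by simp
  thus False using small(1)[of j] sum_less by linarith
qed

text \<open>The first inequality provides the forms, the second and third exclude the identity
  \<open>\<Phi> = 0\<close>, and the last two enforce it: \<open>M\<close> stays within the range of
  invertible factorials, and the orders at the roots exceed the degree.\<close>

theorem not_split:
  assumes "(\<Sum>n<M. H + n + 1) < 2 * (D + 1) * (H + 1)" "2 * H + 1 < m" "D < CARD('p)"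
    "M \<le> CARD('p)" "H + D * m + (CARD('p) - 1) < M * m"
  shows "size (proots f) \<noteq> degree f"
proof
  assume split: "size (proots f) = degree f"
  obtain A B where AB: "A \<noteq> 0 \<or> B \<noteq> 0" "degree A \<le> D" "degree B \<le> D" "coeff_degrees_le H A" "coeff_degrees_le H B"
    and van: "\<And>n. n < M \<Longrightarrow> coeff ((form_deriv D ^^ n) A) D + coeff ((form_deriv_twisted D ^^ n) B) D = 0"
    using exists_forms[OF assms(1)] by metis
  have "form_value D A + Ep * form_value D B = 0"
    using auxiliary_poly_eq_0[OF split AB(2-5) van assms(4,5)] by blast
  moreover have "form_value D A + Ep * form_value D B \<noteq> 0"
    using auxiliary_poly_nonzero[OF split AB(2-5,1) assms(2,3)] .
  ultimately show False by contradiction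
qed

end

section \<open>Split polynomials\<close>

lemma size_proots_mult_eq_degree_iff:
  fixes P Q :: "'a::idom poly"
  assumes "P \<noteq> 0" "Q \<noteq> 0"
  shows "size (proots (P * Q)) = degree (P * Q) \<longleftrightarrow>
    size (proots P) = degree P \<and> size (proots Q) = degree Q"
  using assms size_proots_le[of P] size_proots_le[of Q]
  by (auto simp: proots_mult degree_mult_eq)

lemma size_proots_linear:
  fixes P :: "'a::field poly"
  assumes "degree P \<le> 1" "P \<noteq> 0"
  shows "size (proots P) = degree P"
proof (cases "degree P = 0")
  case True
  then show ?thesis by (auto elim!: degree_eq_zeroE)
next
  case False
  with assms(1) have deg: "degree P = 1" by simp
  then obtain a b where P: "P = [:a, b:]" "b \<noteq> 0"
    by (metis degree_pCons_eq_if degree_eq_zeroE pCons_cases degree_0 One_nat_def nat.inject zero_neq_one pCons_eq_0_iff)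
  have "poly P (- a / b) = 0" using P by simp
  hence "- a / b \<in># proots P" using assms(2) by simp
  hence "proots P \<noteq> {#}" by auto
  hence "size (proots P) \<noteq> 0" by simp
  thus ?thesis using size_proots_le[of P] deg by linarith
qed

lemma split_poly_induct [consumes 2, case_names const linear]:
  fixes P :: "'a::field poly"
  assumes "P \<noteq> 0" "size (proots P) = degree P"
    and const: "\<And>c. c \<noteq> 0 \<Longrightarrow> R [:c:]"
    and linear: "\<And>a P. P \<noteq> 0 \<Longrightarrow> R P \<Longrightarrow> R ([:- a, 1:] * P)"
  shows "R P"
  using assms(1,2)
proof (induction "degree P" arbitrary: P)
  case 0
  then obtain c where "P = [:c:]" "c \<noteq> 0" by (metis degree_eq_zeroE pCons_0_0)
  then show ?case by (simp add: const)
next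
  case (Suc n)
  hence "proots P \<noteq> {#}" by auto
  then obtain a where "a \<in># proots P" by blast
  hence "poly P a = 0" using Suc.prems(1) by simp
  then obtain Q where Q: "P = [:- a, 1:] * Q" by (metis poly_eq_0_iff_dvd dvdE)
  have nz: "Q \<noteq> 0" using Q Suc.prems(1) by auto
  have "size (proots Q) = degree Q"
    using Suc.prems(2) nz unfolding Q by (subst (asm) size_proots_mult_eq_degree_iff) auto
  moreover have "degree Q = n" using Suc.hyps(2) nz unfolding Q by (subst (asm) degree_mult_eq) auto
  ultimately show ?case using Suc.hyps(1)[of Q] nz linear unfolding Q by blast
qed

lemma split_reflect_poly:
  fixes P :: "'a::field poly"
  assumes "P \<noteq> 0" "size (proots P) = degree P"
  shows "size (proots (reflect_poly P)) = degree (reflect_poly P)"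
  using assms
proof (induction P rule: split_poly_induct)
  case (linear a P)
  have "reflect_poly [:- a, 1:] = [:1, - a:]"
    by (cases "a = 0") (simp_all add: reflect_poly_def)
  hence "size (proots (reflect_poly [:- a, 1:])) = degree (reflect_poly [:- a, 1:])"
    by (intro size_proots_linear) auto
  thus ?case
    using linear unfolding reflect_poly_mult by (subst size_proots_mult_eq_degree_iff) auto
qed simp

lemma split_pcompose_linear:
  fixes P :: "'a::field poly"
  assumes "P \<noteq> 0" "size (proots P) = degree P" "c \<noteq> 0"
  shows "size (proots (P \<circ>\<^sub>p [:0, c:])) = degree (P \<circ>\<^sub>p [:0, c:])"
  using assms(1,2)
proof (induction P rule: split_poly_induct)
  case (linear a P)
  have 1: "[:- a, 1:] \<circ>\<^sub>p [:0, c:] = [:- a, c:]" by (simp add: pcompose_pCons)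
  have "size (proots [:- a, c:]) = degree [:- a, c:]"
    using assms(3) by (intro size_proots_linear) auto
  moreover have "P \<circ>\<^sub>p [:0, c:] \<noteq> 0"
    using linear(1) pcompose_eq_0[of P "[:0, c:]"] assms(3) by auto
  ultimately show ?case
    using linear assms(3) unfolding pcompose_mult 1 by (subst size_proots_mult_eq_degree_iff) auto
qed simp

text \<open>Scaling the variable is invertible, and reflection is an involution on polynomials with
  nonzero constant term, so one direction for each operation suffices.\<close>

lemma split_reflect_pcompose_iff:
  fixes P :: "'a::field poly"
  assumes "coeff P 0 \<noteq> 0" "c \<noteq> 0"
  defines "Q \<equiv> reflect_poly (P \<circ>\<^sub>p [:0, c:])"
  shows "size (proots Q) = degree Q \<longleftrightarrow> size (proots P) = degree P"
proof
  have P0: "P \<noteq> 0" using assms(1) by auto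
  have nz: "P \<circ>\<^sub>p [:0, c:] \<noteq> 0" using P0 pcompose_eq_0[of P "[:0, c:]"] assms(2) by auto
  have c0: "coeff (P \<circ>\<^sub>p [:0, c:]) 0 \<noteq> 0" using assms(1) by (simp add: poly_0_coeff_0)
  have "P \<circ>\<^sub>p [:0, c:] \<circ>\<^sub>p [:0, 1 / c:] = P"
    using assms(2) by (simp flip: pcompose_assoc add: pcompose_pCons)
  moreover have "reflect_poly Q = P \<circ>\<^sub>p [:0, c:]" using c0 by (simp add: Q_def)
  moreover have "Q \<noteq> 0" using nz by (simp add: Q_def)
  ultimately show "size (proots P) = degree P" if "size (proots Q) = degree Q"
    using split_pcompose_linear[OF nz _, of "1 / c"] split_reflect_poly[of Q] that assms(2) by simp
  show "size (proots Q) = degree Q" if "size (proots P) = degree P"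
    unfolding Q_def by (intro split_reflect_poly nz split_pcompose_linear P0 that assms(2))
qed

text \<open>Both sides are additive over the prime factorization, and a prime factor has a root
  exactly if it is linear.\<close>

lemma num_linear_factors_eq_size_proots:
  fixes P :: "'p::prime_card mod_ring poly"
  assumes "P \<noteq> 0"
  shows "num_linear_factors P = size (proots P)"
  using assms
proof (induction P rule: prime_divisors_induct)
  case (unit P)
  hence "degree P = 0" by (simp add: is_unit_iff_degree)
  thus ?case using unit size_proots_le[of P]
    by (simp add: num_linear_factors_def prime_factorization_unit)
next
  case (factor q P)
  hence nz: "P \<noteq> 0" "q \<noteq> 0" by auto
  have irr: "irreducible q" using factor(1) by (simp add: prime_elem_imp_irreducible prime_imp_prime_elem)
  have "size (proots q) = (if degree q = 1 then 1 else 0)"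
  proof (cases "degree q = 1")
    case True
    thus ?thesis using size_proots_linear[of q] nz by simp
  next
    case False
    have "proots q = {#}"
    proof (rule ccontr)
      assume "proots q \<noteq> {#}"
      then obtain a where "a \<in># proots q" by blast
      hence "poly q a = 0" using nz by simp
      then obtain r where r: "q = [:- a, 1:] * r" by (metis poly_eq_0_iff_dvd dvdE)
      hence "is_unit [:- a, 1:] \<or> is_unit r" using irr by (metis irreducibleD)
      hence "is_unit r" by (auto simp: is_unit_iff_degree)
      hence "degree r = 0" using nz r by (auto simp: is_unit_iff_degree)
      hence "degree q = 1" using nz r by (simp add: degree_mult_eq del: mult_pCons_left)
      thus False using False by simp
    qed
    thus ?thesis using False by simp
  qed
  thus ?case
    using factor nz
    by (simp add: num_linear_factors_def prime_factorization_mult prime_factorization_prime proots_mult)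
qed simp

section \<open>Reduction of rational numbers modulo a prime\<close>

text \<open>Any fraction with denominator prime to p may serve as witness, which makes the relation
  compatible with sums and products; \<open>rat_mod\<close> itself refers to lowest terms.\<close>

definition reduces_to :: "rat \<Rightarrow> 'p::prime_card mod_ring \<Rightarrow> bool" where
  "reduces_to r c \<longleftrightarrow> (\<exists>x y. of_int y \<noteq> (0 :: 'p mod_ring) \<and> r = of_int x / of_int y \<and> c = of_int x / of_int y)"

lemma of_int_mod_ring_eq_0_iff: "(of_int x :: 'p::prime_card mod_ring) = 0 \<longleftrightarrow> int CARD('p) dvd x"
  using of_int_eq_0_iff_char_dvd[where ?'a = "'p mod_ring", of x] by simp

lemma rat_mod_eqI:
  assumes "reduces_to r (c :: 'p::prime_card mod_ring)"
  shows "rat_mod r = c"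
proof -
  obtain x y where xy: "of_int y \<noteq> (0 :: 'p mod_ring)" "r = of_int x / of_int y"
    "c = of_int x / of_int y" using assms unfolding reduces_to_def by metis
  obtain n d where q: "quotient_of r = (n, d)" by fastforce
  have d: "d > 0" and cop: "coprime n d" and r: "r = of_int n / of_int d"
    using quotient_of_denom_pos[OF q] quotient_of_coprime[OF q] quotient_of_div[OF q] by auto
  have "y \<noteq> 0" using xy(1) by auto
  hence "(of_int (n * y) :: rat) = of_int (x * d)"
    using xy(2) r d by (simp add: field_simps)
  hence eq: "n * y = x * d" by (simp only: of_int_eq_iff)
  have prime: "prime (int CARD('p))" using prime_card[where ?'a = 'p] by simp
  have "\<not> int CARD('p) dvd d"
  proof
    assume dvd: "int CARD('p) dvd d"
    hence "int CARD('p) dvd n * y" unfolding eq by simp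
    hence "int CARD('p) dvd n"
      using xy(1) prime by (simp add: prime_dvd_mult_iff of_int_mod_ring_eq_0_iff)
    with dvd cop have "is_unit (int CARD('p))" by (metis coprime_common_divisor)
    thus False using prime by auto
  qed
  hence "(of_int d :: 'p mod_ring) \<noteq> 0" by (simp add: of_int_mod_ring_eq_0_iff)
  moreover have "(of_int n * of_int y :: 'p mod_ring) = of_int x * of_int d"
    using arg_cong[OF eq, of "of_int :: int \<Rightarrow> 'p mod_ring"] by simp
  ultimately show ?thesis using xy(1) by (simp add: rat_mod_def q xy(3) frac_eq_eq)
qed

lemma reduces_to_of_int: "reduces_to (of_int x) (of_int x)"
  unfolding reduces_to_def by (rule exI[of _ x], rule exI[of _ 1]) simp

lemma reduces_to_divide_int: "of_int y \<noteq> (0 :: 'p::prime_card mod_ring) \<Longrightarrow>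
    reduces_to (of_int x / of_int y) (of_int x / of_int y :: 'p mod_ring)"
  unfolding reduces_to_def by (rule exI[of _ x], rule exI[of _ y]) simp

lemma rmodE:
  assumes "reduces_to r (c :: 'p::prime_card mod_ring)"
  obtains x y where "of_int y \<noteq> (0 :: 'p mod_ring)" "y \<noteq> 0"
    "r = of_int x / of_int y" "c = of_int x / of_int y"
  using assms unfolding reduces_to_def by (metis of_int_0)

lemma reduces_to_add:
  assumes "reduces_to r (c :: 'p::prime_card mod_ring)" "reduces_to s d"
  shows "reduces_to (r + s) (c + d)"
proof -
  obtain x y where 1: "of_int y \<noteq> (0 :: 'p mod_ring)" "y \<noteq> 0"
    "r = of_int x / of_int y" "c = of_int x / of_int y" using assms(1) by (rule rmodE)
  obtain x' y' where 2: "of_int y' \<noteq> (0 :: 'p mod_ring)" "y' \<noteq> 0"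
    "s = of_int x' / of_int y'" "d = of_int x' / of_int y'" using assms(2) by (rule rmodE)
  have "r + s = of_int (x * y' + x' * y) / of_int (y * y')"
    using 1(2) 2(2) unfolding 1(3) 2(3) by (simp add: add_frac_eq)
  moreover have "c + d = of_int (x * y' + x' * y) / of_int (y * y')"
    using 1(1) 2(1) unfolding 1(4) 2(4) by (simp add: add_frac_eq)
  moreover have "of_int (y * y') \<noteq> (0 :: 'p mod_ring)" using 1(1) 2(1) by simp
  ultimately show ?thesis using reduces_to_divide_int by metis
qed

lemma reduces_to_mult:
  assumes "reduces_to r (c :: 'p::prime_card mod_ring)" "reduces_to s d"
  shows "reduces_to (r * s) (c * d)"
proof -
  obtain x y where 1: "of_int y \<noteq> (0 :: 'p mod_ring)" "y \<noteq> 0"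
    "r = of_int x / of_int y" "c = of_int x / of_int y" using assms(1) by (rule rmodE)
  obtain x' y' where 2: "of_int y' \<noteq> (0 :: 'p mod_ring)" "y' \<noteq> 0"
    "s = of_int x' / of_int y'" "d = of_int x' / of_int y'" using assms(2) by (rule rmodE)
  have "r * s = of_int (x * x') / of_int (y * y')" "c * d = of_int (x * x') / of_int (y * y')"
    by (simp_all add: 1 2)
  moreover have "of_int (y * y') \<noteq> (0 :: 'p mod_ring)" using 1(1) 2(1) by simp
  ultimately show ?thesis using reduces_to_divide_int by metis
qed

lemma reduces_to_inverse_of_nat:
  assumes "of_nat n \<noteq> (0 :: 'p::prime_card mod_ring)"
  shows "reduces_to (1 / of_nat n) (1 / of_nat n :: 'p mod_ring)"
  using reduces_to_divide_int[of "int n" 1] assms by simp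

lemma reduces_to_of_nat: "reduces_to (of_nat n) (of_nat n)"
  using reduces_to_of_int[of "int n"] by simp

lemma reduces_to_0: "reduces_to 0 0" and reduces_to_1: "reduces_to 1 1"
  using reduces_to_of_nat[of 0] reduces_to_of_nat[of 1] by simp_all

lemma reduces_to_power: "reduces_to r c \<Longrightarrow> reduces_to (r ^ n) (c ^ n)"
  unfolding power_Suc by (induction n) (auto intro: reduces_to_1 reduces_to_mult)

lemma reduces_to_pochhammer: "reduces_to r c \<Longrightarrow> reduces_to (pochhammer r n) (pochhammer c n)"
proof (induction n)
  case (Suc n)
  then show ?case unfolding pochhammer_Suc by (intro reduces_to_mult reduces_to_add reduces_to_of_nat)
qed (simp add: reduces_to_1)

lemma pochhammer_minus_of_nat:
  "pochhammer (- of_nat m :: 'a::comm_ring_1) n = (- 1) ^ n * of_nat (fact n * (m choose n))"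
proof (induction n)
  case (Suc n)
  have "of_nat ((m - n) * (m choose n)) = (of_nat m - of_nat n) * (of_nat (m choose n) :: 'a)"
    by (cases "n \<le> m") (auto simp: of_nat_diff binomial_eq_0)
  moreover have "fact (Suc n) * (m choose Suc n) = fact n * ((m - n) * (m choose n))"
    using binomial_absorption[of n m] binomial_absorb_comp[of m n]
    by (metis fact_Suc mult.assoc mult.commute of_nat_id)
  ultimately show ?case
    unfolding pochhammer_Suc Suc.IH by (simp add: algebra_simps)
qed simp

text \<open>Modulo p the parameter \<open>\<beta>\<close> becomes the negative integer
  \<open>- b\<close>, so both Pochhammer symbols become binomial coefficients times
  \<open>fact n\<close>, with cancelling signs.\<close>

lemma reduces_to_hyp2F1_coeff:
  fixes b :: nat
  assumes \<beta>: "reduces_to \<beta> (- of_nat b :: 'p::prime_card mod_ring)" and n: "n < CARD('p)"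
  shows "reduces_to (hyp2F1_coeff m \<beta> n) (of_nat ((m choose n) * (b choose n)) :: 'p mod_ring)"
proof -
  have "\<not> CARD('p) dvd fact n"
    using n prime_dvd_fact_iff[OF prime_card[where ?'a = 'p], of n] by simp
  hence nz: "of_nat (fact n) \<noteq> (0 :: 'p mod_ring)" using of_nat_0_mod_ring_dvd by blast
  have "reduces_to (- of_nat m) (- of_nat m :: 'p mod_ring)" using reduces_to_of_int[of "- int m"] by simp
  hence "reduces_to (pochhammer (- of_nat m) n * pochhammer \<beta> n * (1 / of_nat (fact n)) ^ 2)
      (pochhammer (- of_nat m) n * pochhammer (- of_nat b) n * (1 / of_nat (fact n)) ^ 2 :: 'p mod_ring)"
    by (intro reduces_to_mult reduces_to_pochhammer reduces_to_power reduces_to_inverse_of_nat nz \<beta>)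
  moreover have "pochhammer (- of_nat m) n * pochhammer (- of_nat b) n * (1 / of_nat (fact n)) ^ 2 =
      (of_nat ((m choose n) * (b choose n)) :: 'p mod_ring)"
    unfolding pochhammer_minus_of_nat using nz
    by (simp add: field_simps power2_eq_square del: of_nat_fact flip: power_mult_distrib)
  ultimately show ?thesis
    by (simp add: hyp2F1_coeff_def power_divide)
qed

definition poly_reduces_to :: "rat poly \<Rightarrow> 'p::prime_card mod_ring poly \<Rightarrow> bool" where
  "poly_reduces_to P Q \<longleftrightarrow> (\<forall>i. reduces_to (coeff P i) (coeff Q i))"

lemma reduces_to_sum: "(\<And>x. x \<in> A \<Longrightarrow> reduces_to (h x) (k x)) \<Longrightarrow> reduces_to (sum h A) (sum k A)"
  by (induction A rule: infinite_finite_induct) (simp_all add: reduces_to_0 reduces_to_add)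

lemma poly_reduces_to_mult: "poly_reduces_to P Q \<Longrightarrow> poly_reduces_to P' Q' \<Longrightarrow> poly_reduces_to (P * P') (Q * Q')"
  unfolding poly_reduces_to_def coeff_mult by (intro allI reduces_to_sum reduces_to_mult) auto

lemma poly_reduces_to_sum: "(\<And>x. x \<in> A \<Longrightarrow> poly_reduces_to (h x) (k x)) \<Longrightarrow> poly_reduces_to (sum h A) (sum k A)"
  unfolding poly_reduces_to_def coeff_sum by (intro allI reduces_to_sum) auto

lemma poly_reduces_to_power: "poly_reduces_to P Q \<Longrightarrow> poly_reduces_to (P ^ n) (Q ^ n)"
proof (induction n)
  case 0
  then show ?case by (auto simp: poly_reduces_to_def reduces_to_0 reduces_to_1)
qed (simp add: poly_reduces_to_mult)

lemma poly_reduces_to_monom: "reduces_to r c \<Longrightarrow> poly_reduces_to (monom r n) (monom c n)"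
  by (auto simp: poly_reduces_to_def reduces_to_0)

lemma map_poly_rat_mod_eqI: "poly_reduces_to P Q \<Longrightarrow> map_poly rat_mod P = Q"
  by (rule poly_eqI)
     (simp add: poly_reduces_to_def coeff_map_poly rat_mod_eqI rat_mod_eqI[OF reduces_to_0])

text \<open>The reduction is X^k (X - c)^l times X^m h(c/X), where h is \<open>hyp_poly m b\<close>;
  the extra linear factors do not affect splitting.\<close>

lemma split_hyp2F1_rev_poly:
  fixes b c m k l :: nat
  assumes \<beta>: "reduces_to \<beta> (- of_nat b :: 'p::prime_card mod_ring)"
    and c: "\<not> CARD('p) dvd c" and mb: "m \<le> b" "b < CARD('p)"
  defines "Q \<equiv> map_poly rat_mod (hyp2F1_rev_poly (m + k) m \<beta> (of_nat c) * [:- of_nat c, 1:] ^ l)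
    :: 'p mod_ring poly"
  shows "Q \<noteq> 0 \<and> (degree Q = num_linear_factors Q \<longleftrightarrow>
    size (proots (hyp_poly m b :: 'p mod_ring poly)) = m)"
proof -
  let ?h = "hyp_poly m b :: 'p mod_ring poly"
  have c0: "of_nat c \<noteq> (0 :: 'p mod_ring)" using c of_nat_0_mod_ring_dvd by blast
  define S where "S = reflect_poly (?h \<circ>\<^sub>p [:0, of_nat c:])"
  have h0: "coeff ?h 0 = 1" by (simp add: coeff_hyp_poly)
  hence hnz: "?h \<noteq> 0" by auto
  have "\<not> CARD('p) dvd (b choose m)"
  proof
    assume "CARD('p) dvd (b choose m)"
    hence "CARD('p) dvd fact b" using binomial_fact_lemma[OF mb(1)] by (metis dvd_mult)
    thus False using mb(2) prime_dvd_fact_iff[OF prime_card[where ?'a = 'p], of b] by simp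
  qed
  hence "coeff ?h m \<noteq> 0" using of_nat_0_mod_ring_dvd by (auto simp: coeff_hyp_poly)
  hence deg: "degree ?h = m"
    by (intro antisym le_degree) (auto intro!: degree_le simp: coeff_hyp_poly binomial_eq_0)
  have deg': "degree (?h \<circ>\<^sub>p [:0, of_nat c:]) = m" using c0 by (simp add: degree_pcompose deg)
  have S: "S = (\<Sum>n\<le>m. monom (of_nat ((m choose n) * (b choose n)) * of_nat c ^ n) (m - n))"
  proof (rule poly_eqI)
    fix i
    have "(\<Sum>n\<le>m. coeff (monom (of_nat ((m choose n) * (b choose n)) * of_nat c ^ n :: 'p mod_ring) (m - n)) i) =
      (\<Sum>n\<le>m. if n = m - i \<and> i \<le> m then of_nat ((m choose n) * (b choose n)) * of_nat c ^ n else 0)"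
      by (intro sum.cong refl) auto
    also have "\<dots> = coeff S i"
      by (cases "i \<le> m")
         (auto simp: S_def coeff_reflect_poly deg' coeff_pcompose_linear coeff_hyp_poly mult_ac deg c0)
    finally show "coeff S i = coeff (\<Sum>n\<le>m. monom (of_nat ((m choose n) * (b choose n)) * of_nat c ^ n) (m - n)) i"
      by (simp add: coeff_sum)
  qed
  have "Q = (\<Sum>n\<le>m. monom (of_nat ((m choose n) * (b choose n)) * of_nat c ^ n) (m + k - n)) * [:- of_nat c, 1:] ^ l"
    unfolding Q_def hyp2F1_rev_poly_def
  proof (intro map_poly_rat_mod_eqI poly_reduces_to_mult poly_reduces_to_sum poly_reduces_to_power poly_reduces_to_monom
      reduces_to_mult reduces_to_power reduces_to_of_nat)
    show "reduces_to (hyp2F1_coeff m \<beta> n) (of_nat ((m choose n) * (b choose n)) :: 'p mod_ring)" if "n \<in> {..m}" for n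
      using that mb by (intro reduces_to_hyp2F1_coeff \<beta>) auto
    show "poly_reduces_to [:- of_nat c, 1:] [:- of_nat c, 1 :: 'p mod_ring:]"
      using reduces_to_of_int[of "- int c", where ?'a = 'p]
      by (auto simp: poly_reduces_to_def coeff_pCons reduces_to_0 reduces_to_1 split: nat.split)
  qed
  also have "(\<Sum>n\<le>m. monom (of_nat ((m choose n) * (b choose n)) * of_nat c ^ n) (m + k - n)) =
      monom 1 k * S"
    unfolding S sum_distrib_left by (intro sum.cong refl) (simp add: mult_monom add.commute)
  finally have Q: "Q = monom 1 k * S * [:- of_nat c, 1:] ^ l" .
  have Snz: "S \<noteq> 0" using pcompose_eq_0[of ?h "[:0, of_nat c:]"] hnz c0 by (auto simp: S_def)
  have Qnz: "Q \<noteq> 0" using Snz by (simp add: Q monom_eq_0_iff)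
  have power: "size (proots (P ^ n)) = degree (P ^ n)" if "P \<noteq> 0" "degree P = 1" for P :: "'p mod_ring poly" and n
    using that size_proots_linear[of P] by (simp add: proots_power degree_power_eq)
  have "size (proots (monom 1 k :: 'p mod_ring poly)) = degree (monom 1 k :: 'p mod_ring poly)"
    using power[of "[:0, 1:]" k] by (simp add: monom_altdef)
  hence "size (proots Q) = degree Q \<longleftrightarrow> size (proots S) = degree S"
    unfolding Q using Snz power[of "[:- of_nat c, 1:]" l]
    by (simp add: size_proots_mult_eq_degree_iff monom_eq_0_iff del: mult_pCons_left mult_pCons_right)
  also have "\<dots> \<longleftrightarrow> size (proots ?h) = degree ?h"
    unfolding S_def using h0 c0 by (intro split_reflect_pcompose_iff) auto
  finally have "degree Q = size (proots Q) \<longleftrightarrow> size (proots ?h) = m"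
    unfolding deg by (rule trans[OF eq_commute])
  with Qnz show ?thesis unfolding num_linear_factors_eq_size_proots[OF Qnz] by (rule conjI)
qed

section \<open>The supersingular polynomials as hypergeometric polynomials\<close>

lemma Legendre_cong_unique:
  fixes x y :: int
  assumes "[x = y] (mod int p)" "x \<in> {1, -1}" "y \<in> {1, -1}" "2 < p"
  shows "x = y"
proof -
  have dvd: "int p dvd x - y" using assms(1) by (simp add: cong_iff_dvd_diff)
  show ?thesis
  proof (rule ccontr)
    assume "x \<noteq> y"
    hence "x - y = 2 \<or> x - y = - 2" using assms(2,3) by auto
    hence "int p dvd 2" using dvd by auto
    thus False using assms(4) by (auto dest: zdvd_imp_le)
  qed
qed

lemma Legendre_pm1: "\<not> int p dvd a \<Longrightarrow> Legendre a (int p) \<in> {1, -1}"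
  by (simp add: Legendre_def cong_0_iff)

lemma Legendre_minus:
  assumes "prime p" "2 < p" "\<not> int p dvd a"
  shows "Legendre (- a) (int p) = (- 1) ^ ((p - 1) div 2) * Legendre a (int p)"
proof (rule Legendre_cong_unique)
  have "[Legendre (- a) (int p) = (- a) ^ ((p - 1) div 2)] (mod int p)"
    using euler_criterion[OF assms(1,2)] .
  also have "(- a) ^ ((p - 1) div 2) = (- 1) ^ ((p - 1) div 2) * a ^ ((p - 1) div 2)"
    by (rule power_minus)
  also have "[\<dots> = (- 1) ^ ((p - 1) div 2) * Legendre a (int p)] (mod int p)"
    using euler_criterion[OF assms(1,2)] by (intro cong_scalar_left) (rule cong_sym)
  finally show "[Legendre (- a) (int p) = (- 1) ^ ((p - 1) div 2) * Legendre a (int p)] (mod int p)" .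
  show "Legendre (- a) (int p) \<in> {1, -1}" using assms(3) by (intro Legendre_pm1) simp
  show "(- 1) ^ ((p - 1) div 2) * Legendre a (int p) \<in> {1, -1}"
    using Legendre_pm1[OF assms(3)] by (cases "even ((p - 1) div 2)") auto
qed fact

lemma Legendre_1: "2 < p \<Longrightarrow> Legendre 1 (int p) = 1"
  by (auto simp: Legendre_def cong_0_iff QuadRes_def intro!: exI[of _ 1] dest: zdvd_imp_le)

lemma Legendre_2:
  assumes "prime p" "2 < p"
  shows "Legendre 2 (int p) = (- 1) ^ ((p - 1) div 2 - (p - 1) div 2 div 2)"
proof -
  have odd: "odd p" using assms by (simp add: prime_odd_nat)
  interpret GAUSS p 2
    using assms by unfold_locales (auto simp: cong_0_iff dest: zdvd_imp_le)
  define h where "h = (int p - 1) div 2"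
  have h: "int p = 2 * h + 1" using odd unfolding h_def by presburger
  \<comment> \<open>Gauss's lemma counts the x in 1..h for which 2x exceeds h = (p - 1)/2.\<close>
  have "E = (\<lambda>x. x * 2) ` {h div 2 <.. h}"
  proof -
    have "C = (\<lambda>x. x * 2) ` {0 <.. h}"
      unfolding C_def B_def A_def h_def[symmetric] image_image
      using h by (intro image_cong refl) auto
    thus ?thesis unfolding E_def h_def[symmetric] by auto
  qed
  hence "card E = card {h div 2 <.. h}" by (simp add: card_image inj_on_def)
  also have "\<dots> = nat (h - h div 2)" by simp
  also have "\<dots> = (p - 1) div 2 - (p - 1) div 2 div 2" using h assms(2) by linarith
  finally show ?thesis using gauss_lemma by simp
qed

lemma eps_nu_values:
  assumes "prime p" "2 < p"
  shows "eps p = (if p mod 4 = 1 then 0 else 1)" "nu p = (if p mod 8 \<in> {1, 3} then 0 else 1)"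
proof -
  have ndvd: "\<not> int p dvd 1" "\<not> int p dvd 2" using assms(2) by (auto dest: zdvd_imp_le)
  have L1: "Legendre (- 1) (int p) = (- 1) ^ ((p - 1) div 2)"
    using Legendre_minus[OF assms ndvd(1)] Legendre_1[OF assms(2)] by simp
  have L2: "Legendre (- 2) (int p) = (- 1) ^ ((p - 1) div 2 + ((p - 1) div 2 - (p - 1) div 2 div 2))"
    using Legendre_minus[OF assms ndvd(2)] Legendre_2[OF assms] by (simp only: power_add)
  have "odd p" using assms by (simp add: prime_odd_nat)
  then obtain q where p: "p = 2 * q + 1" by (elim oddE)
  have "even q \<longleftrightarrow> p mod 4 = 1" unfolding p by presburger
  thus "eps p = (if p mod 4 = 1 then 0 else 1)"
    unfolding eps_def L1 by (simp add: p)
  define j r where "j = q div 4" and "r = q mod 4"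
  have q: "q = 4 * j + r" and "r < 4" by (simp_all add: j_def r_def)
  hence r: "r = 0 \<or> r = 1 \<or> r = 2 \<or> r = 3" by linarith
  have "p = 8 * j + (2 * r + 1)" by (simp add: p q)
  hence "p mod 8 = (2 * r + 1) mod 8" by (metis mod_mult_self4)
  hence "p mod 8 = 2 * r + 1" using \<open>r < 4\<close> by simp
  moreover have "q div 2 = 2 * j + r div 2"
    using div_mult_self3[of 2 "2 * j" r] by (simp add: q mult.commute)
  hence "even (q + (q - q div 2)) \<longleftrightarrow> r = 0 \<or> r = 1"
    using r by (elim disjE) (simp_all add: q)
  ultimately show "nu p = (if p mod 8 \<in> {1, 3} then 0 else 1)"
    unfolding nu_def L2 using r by (auto simp: p)
qed

text \<open>Reciprocity turns (-3/p) into (p/3), the signs from -1 and from reciprocity cancelling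
  each other.\<close>

lemma delta_value:
  assumes "prime p" "3 < p"
  shows "delta p = (if p mod 3 = 1 then 0 else 1)"
proof -
  have "\<not> int p dvd 3" using assms(2) by (auto dest: zdvd_imp_le)
  hence "Legendre (- 3) (int p) = (- 1) ^ ((p - 1) div 2) * Legendre 3 (int p)"
    using Legendre_minus[OF assms(1)] assms(2) by simp
  moreover have "Legendre (int p) 3 * Legendre 3 (int p) = (- 1) ^ ((p - 1) div 2)"
    using Quadratic_Reciprocity[of p 3] assms by simp
  moreover have "Legendre 3 (int p) * Legendre 3 (int p) = 1"
    using Legendre_pm1[OF \<open>\<not> int p dvd 3\<close>] by auto
  ultimately have L: "Legendre (- 3) (int p) = Legendre (int p) 3"
    by (metis mult.assoc mult.right_neutral)
  have "\<not> 3 dvd p" using assms primes_dvd_imp_eq[of 3 p] by auto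
  hence "p mod 3 = 1 \<or> p mod 3 = 2" by presburger
  thus ?thesis
  proof
    assume p: "p mod 3 = 1"
    hence "int p mod 3 = 1" by presburger
    hence "Legendre (int p) 3 = 1"
      by (auto simp: Legendre_def cong_def QuadRes_def intro!: exI[of _ 1])
    thus ?thesis using p by (simp add: delta_def L)
  next
    assume p: "p mod 3 = 2"
    hence p': "int p mod 3 = 2" by presburger
    have "y\<^sup>2 mod 3 \<noteq> 2" for y :: int
    proof -
      have "y mod 3 \<in> {0, 1, 2}" by (simp; presburger)
      thus ?thesis using power_mod[of y 3 2] by auto
    qed
    hence "Legendre (int p) 3 = - 1"
      using p' by (auto simp: Legendre_def cong_def QuadRes_def)
    thus ?thesis using p by (simp add: delta_def L)
  qed
qed

lemma reduces_to_fraction: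
  fixes b k q t :: nat
  assumes "q * b + k = t * CARD('p::prime_card)" "\<not> CARD('p) dvd q"
  shows "reduces_to (of_nat k / of_nat q) (- of_nat b :: 'p mod_ring)"
proof -
  have q: "of_nat q \<noteq> (0 :: 'p mod_ring)" using assms(2) of_nat_0_mod_ring_dvd by blast
  have "of_nat q * of_nat b + of_nat k = (0 :: 'p mod_ring)"
    using arg_cong[OF assms(1), of "of_nat :: nat \<Rightarrow> 'p mod_ring"] by simp
  hence "of_nat k = - (of_nat b * of_nat q :: 'p mod_ring)"
    by (metis add.commute eq_neg_iff_add_eq_0 mult.commute)
  hence "of_nat k / of_nat q = (- of_nat b :: 'p mod_ring)" using q by simp
  moreover have "reduces_to (of_nat k / of_nat q) (of_nat k / of_nat q :: 'p mod_ring)"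
    using reduces_to_divide_int[of "int q" "int k", where ?'p = 'p] q by simp
  ultimately show ?thesis by simp
qed

lemma prime_not_dvd_power:
  fixes p q :: nat
  assumes "prime p" "prime q" "p \<noteq> q"
  shows "\<not> p dvd q ^ n"
  using assms by (metis prime_dvd_power primes_dvd_imp_eq)

lemma ss2_split_iff:
  assumes p: "CARD('p::prime_card) \<ge> 5"
  shows "degree (ss2 :: 'p mod_ring poly) = num_linear_factors (ss2 :: 'p mod_ring poly) \<longleftrightarrow>
    size (proots (hyp_poly (CARD('p) div 8) (3 * CARD('p) div 8) :: 'p mod_ring poly)) = CARD('p) div 8"
proof -
  let ?p = "CARD('p)"
  have prime: "prime ?p" by (rule prime_card)
  \<comment> \<open>\<open>k\<close> is 3p mod 8. Thus k/8 is congruent to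
    \<open>- (3 * p div 8)\<close> modulo p, and the case distinction checks that k/8 is the
    parameter in \<open>ss2_rat\<close>.\<close>
  define k where "k = (if ?p mod 8 = 1 then 3 else if ?p mod 8 = 3 then 1
     else if ?p mod 8 = 5 then 7 else 5 :: nat)"
  have "odd ?p" using prime p by (simp add: prime_odd_nat)
  hence "?p mod 8 = 1 \<or> ?p mod 8 = 3 \<or> ?p mod 8 = 5 \<or> ?p mod 8 = 7" by presburger
  moreover have three: "8 * (3 * ?p div 8) + 3 * (?p mod 8) mod 8 = 3 * ?p" by (simp add: mod_mult_right_eq)
  ultimately have vals: "8 * (3 * ?p div 8) + k = 3 * ?p \<and>
      3 / 8 - (rat_of_nat (eps ?p) - 2 * of_nat (nu ?p)) / 4 = of_nat k / of_nat 8"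
  proof (elim disjE)
    assume "?p mod 8 = 1"
    thus ?thesis
      using p mod_mod_cancel[of 4 8 ?p] three by (simp add: k_def eps_nu_values[OF prime])
  next
    assume "?p mod 8 = 3"
    thus ?thesis
      using p mod_mod_cancel[of 4 8 ?p] three by (simp add: k_def eps_nu_values[OF prime])
  next
    assume "?p mod 8 = 5"
    thus ?thesis
      using p mod_mod_cancel[of 4 8 ?p] three by (simp add: k_def eps_nu_values[OF prime])
  next
    assume "?p mod 8 = 7"
    thus ?thesis
      using p mod_mod_cancel[of 4 8 ?p] three by (simp add: k_def eps_nu_values[OF prime])
  qed
  have n2: "\<not> ?p dvd 2 ^ n" for n using prime_not_dvd_power[OF prime two_is_prime_nat, of n] p by auto
  have "reduces_to (of_nat k / of_nat 8) (- of_nat (3 * ?p div 8) :: 'p mod_ring)"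
    using vals n2[of 3] by (intro reduces_to_fraction[where t = 3]) auto
  moreover have "\<not> ?p dvd 256" using n2[of 8] by simp
  moreover have "(ss2 :: 'p mod_ring poly) = map_poly rat_mod (hyp2F1_rev_poly (?p div 8 + eps ?p) (?p div 8)
      (of_nat k / of_nat 8) (of_nat 256) * [:- of_nat 256, 1:] ^ nu ?p)"
    using p unfolding ss2_def ss2_rat_def conjunct2[OF vals] by simp
  ultimately show ?thesis
    using split_hyp2F1_rev_poly[of "of_nat k / of_nat 8" "3 * ?p div 8" 256 "?p div 8" "eps ?p" "nu ?p", where ?'p = 'p]
      p by simp
qed

lemma ss3_split_iff:
  assumes p: "CARD('p::prime_card) \<ge> 5"
  shows "degree (ss3 :: 'p mod_ring poly) = num_linear_factors (ss3 :: 'p mod_ring poly) \<longleftrightarrow>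
    size (proots (hyp_poly (CARD('p) div 6) (CARD('p) div 3) :: 'p mod_ring poly)) = CARD('p) div 6"
proof -
  let ?p = "CARD('p)"
  have prime: "prime ?p" by (rule prime_card)
  define k where "k = (if ?p mod 3 = 1 then 1 else 2 :: nat)"
  have n2: "\<not> ?p dvd 2 ^ n" for n using prime_not_dvd_power[OF prime two_is_prime_nat, of n] p by auto
  have n3: "\<not> ?p dvd 3 ^ n" for n using prime_not_dvd_power[OF prime, of 3 n] p by auto
  have "\<not> 3 dvd ?p" using prime p primes_dvd_imp_eq[of 3 ?p] by auto
  hence "?p mod 3 = 1 \<or> ?p mod 3 = 2" by presburger
  hence "3 * (?p div 3) + k = 1 * ?p"
    unfolding k_def by (elim disjE; simp; presburger)
  hence "reduces_to (of_nat k / of_nat 3) (- of_nat (?p div 3) :: 'p mod_ring)"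
    using n3[of 1] by (intro reduces_to_fraction[where t = 1]) auto
  moreover have "\<not> ?p dvd 108"
  proof -
    have "\<not> ?p dvd 2 ^ 2 * 3 ^ 3" using prime n2 n3 by (metis prime_dvd_mult_iff)
    thus ?thesis by simp
  qed
  moreover have "(ss3 :: 'p mod_ring poly) = map_poly rat_mod (hyp2F1_rev_poly (?p div 6 + delta ?p) (?p div 6)
      (of_nat k / of_nat 3) (of_nat 108) * [:- of_nat 108, 1:] ^ delta ?p)"
  proof -
    have \<beta>: "1 / 3 + rat_of_nat (delta ?p) / 3 = of_nat k / of_nat 3"
      using p by (simp add: k_def delta_value[OF prime])
    show ?thesis using p unfolding ss3_def ss3_rat_def \<beta> by simp
  qed
  moreover have "?p div 6 \<le> ?p div 3" by (rule div_le_mono2) simp_all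
  ultimately show ?thesis
    using split_hyp2F1_rev_poly[of "of_nat k / of_nat 3" "?p div 3" 108 "?p div 6" "delta ?p" "delta ?p", where ?'p = 'p]
      p by simp
qed

section \<open>Large primes: choice of the parameters\<close>

lemma hyp_poly_not_split_of_large_prime:
  fixes m b :: nat
  assumes "(\<Sum>n<M. H + n + 1) < 2 * (D + 1) * (H + 1)" "2 * H + 1 < m" "D < M" "M \<le> m"
    "H + D * m + (CARD('p::prime_card) - 1) < M * m" "m \<le> b" "m + b < CARD('p)"
  shows "size (proots (hyp_poly m b :: 'p mod_ring poly)) \<noteq> m"
proof -
  interpret hyp_mod m b "hyp_poly m b :: 'p mod_ring poly" "[:0, 1:] * pderiv (hyp_poly m b)"
    using assms by unfold_locales auto
  show ?thesis using not_split[OF assms(1,2) _ _ assms(5)] assms(3,4,7) degree_f by simp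
qed

lemma hyp2_not_split_of_large_prime:
  assumes "CARD('p::prime_card) \<ge> 512"
  shows "size (proots (hyp_poly (CARD('p) div 8) (3 * CARD('p) div 8) :: 'p mod_ring poly)) \<noteq> CARD('p) div 8"
proof -
  have ineqs: "64 \<le> n div 8 \<and> n \<le> 8 * (n div 8) + 7 \<and> n div 8 \<le> 3 * n div 8 \<and> n div 8 + 3 * n div 8 < n"
    if "512 \<le> n" for n :: nat using that by linarith
  \<comment> \<open>As p > 8m, the degree inequality needs \<open>M >= D + 9\<close>. For
    \<open>M = D + 9\<close> the count reads
    \<open>2 * (D - 7) * (H + 1) > (D + 9) * (D + 8)\<close>; its least solution in \<open>H\<close>
    is 31, first reached at \<open>D = 18\<close>. Then \<open>2 * H + 1 < m\<close> demands
    \<open>m >= 64\<close>, hence the bound 512.\<close>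
  have "(\<Sum>n<27. 31 + n + 1) < 2 * (18 + 1) * (31 + 1 :: nat)" by code_simp
  from hyp_poly_not_split_of_large_prime[where ?'p = 'p, OF this, of "CARD('p) div 8" "3 * CARD('p) div 8"]
  show ?thesis using ineqs[OF assms] by linarith
qed

lemma hyp3_not_split_of_large_prime:
  assumes "CARD('p::prime_card) \<ge> 288"
  shows "size (proots (hyp_poly (CARD('p) div 6) (CARD('p) div 3) :: 'p mod_ring poly)) \<noteq> CARD('p) div 6"
proof -
  have ineqs: "48 \<le> n div 6 \<and> n \<le> 6 * (n div 6) + 5 \<and> n div 6 \<le> n div 3 \<and> n div 6 + n div 3 < n"
    if "288 \<le> n" for n :: nat using that by linarith
  \<comment> \<open>Likewise p > 6m gives \<open>M = D + 7\<close> and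
    \<open>2 * (D - 5) * (H + 1) > (D + 7) * (D + 6)\<close>, with least \<open>H = 23\<close>,
    first reached at \<open>D = 13\<close>. Then \<open>m >= 48\<close>, hence the bound
    288.\<close>
  have "(\<Sum>n<20. 23 + n + 1) < 2 * (13 + 1) * (23 + 1 :: nat)" by code_simp
  from hyp_poly_not_split_of_large_prime[where ?'p = 'p, OF this, of "CARD('p) div 6" "CARD('p) div 3"]
  show ?thesis using ineqs[OF assms] by linarith
qed

section \<open>Explicit quadratic factors for small primes\<close>

text \<open>
  For \<open>x\<close> the class of \<open>X\<close> modulo \<open>X\<^sup>2 - u X - v\<close> the value \<open>(m!)\<^sup>2 * hyp_poly m b (x)\<close> is computed
  by the division-free Horner scheme \<open>G\<^sub>n = K\<^sub>n + s\<^sub>n x G\<^sub>n\<^sub>+\<^sub>1\<close> with \<open>K\<^sub>n = (m! / n!)\<^sup>2\<close> and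
  \<open>s\<^sub>n = (m - n) (b - n)\<close>, where \<open>G\<^sub>n\<close> is represented by the coefficients \<open>g0\<close> and \<open>g1\<close> of
  \<open>g0 + g1 x\<close>. The counter \<open>j\<close> repeats the recursion argument as an integer; \<open>K\<close> and \<open>s\<close> are
  passed one step ahead, so that every argument is a numeral when it gets duplicated.
\<close>

primrec horner_zero ::
    "int \<Rightarrow> int \<Rightarrow> int \<Rightarrow> int \<Rightarrow> int \<Rightarrow> nat \<Rightarrow> int \<Rightarrow> int \<Rightarrow> int \<Rightarrow> int \<Rightarrow> int \<Rightarrow> bool" where
  "horner_zero p m b u v 0 j K s g0 g1 \<longleftrightarrow> g0 mod p = 0 \<and> g1 mod p = 0"
| "horner_zero p m b u v (Suc n) j K s g0 g1 = horner_zero p m b u v n (j - 1)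
     (K * ((j - 1) * (j - 1)) mod p) ((m + 2 - j) * (b + 2 - j))
     ((K + s * v * g1) mod p) (s * (g0 + u * g1) mod p)"

text \<open>The scheme starts at \<open>n = m\<close> with \<open>G = 1\<close>; one step ahead,
  \<open>K\<close> is \<open>m ^ 2\<close> and \<open>s\<close> is
  \<open>1 * (b - (m - 1))\<close>.\<close>

definition quadratic_zero :: "int \<Rightarrow> int \<Rightarrow> int \<Rightarrow> int \<Rightarrow> int \<Rightarrow> bool" where
  "quadratic_zero p m b u v \<longleftrightarrow> horner_zero p m b u v (nat m) m (m * m mod p) (b + 1 - m) 1 0"

lemma of_int_mod_card: "(of_int (x mod int CARD('p)) :: 'p::prime_card mod_ring) = of_int x"
  using of_int_mod_CHAR[where ?'a = "'p mod_ring", of x] by simp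

lemma choose_step:
  "(of_nat ((fact (Suc n))\<^sup>2 * ((m choose Suc n) * (b choose Suc n))) :: 'a::comm_ring_1) =
   of_int ((int m - int n) * (int b - int n)) * of_nat ((fact n)\<^sup>2 * ((m choose n) * (b choose n)))"
proof -
  have step: "int (Suc n * (j choose Suc n)) = (int j - int n) * int (j choose n)" for j
  proof (cases "n \<le> j")
    case True
    have "Suc n * (j choose Suc n) = (j - n) * (j choose n)"
      by (simp only: binomial_absorb_comp binomial_absorption)
    thus ?thesis using True by (metis of_nat_diff of_nat_mult)
  qed (simp add: binomial_eq_0)
  have "int ((fact (Suc n))\<^sup>2 * ((m choose Suc n) * (b choose Suc n))) =
     int ((fact n)\<^sup>2) * (int (Suc n * (m choose Suc n)) * int (Suc n * (b choose Suc n)))"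
    by (simp add: power_mult_distrib power2_eq_square algebra_simps)
  also have "\<dots> = (int m - int n) * (int b - int n) * int ((fact n)\<^sup>2 * ((m choose n) * (b choose n)))"
    unfolding step by simp
  finally have "(of_int (int ((fact (Suc n))\<^sup>2 * ((m choose Suc n) * (b choose Suc n)))) :: 'a) =
    of_int ((int m - int n) * (int b - int n) * int ((fact n)\<^sup>2 * ((m choose n) * (b choose n))))"
    by (rule arg_cong)
  thus ?thesis by (simp only: of_int_mult of_int_of_nat_eq)
qed

text \<open>The invariant is \<open>F n * x ^ n * G n = fm * (\<Sum>k=n..m. c k * x ^ k)\<close>
  modulo \<open>q\<close>. It persists because \<open>F (n + 1) = s n * F n\<close> and
  \<open>K n * (n!) ^ 2 = fm\<close>, and \<open>fm\<close> is invertible since \<open>m\<close> is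
  below the prime.\<close>

lemma quadratic_zero_dvd:
  fixes m b :: nat and u v :: int
  defines "q \<equiv> [:- of_int v, - of_int u, 1:] :: 'p::prime_card mod_ring poly"
  assumes zero: "quadratic_zero (int CARD('p)) (int m) (int b) u v" and m: "m < CARD('p)"
  shows "q dvd hyp_poly m b"
proof -
  define c where "c = (\<lambda>n. of_nat ((m choose n) * (b choose n)) :: 'p mod_ring)"
  define F where "F = (\<lambda>n. of_nat ((fact n)\<^sup>2 * ((m choose n) * (b choose n))) :: 'p mod_ring)"
  define fm where "fm = (of_nat ((fact m)\<^sup>2) :: 'p mod_ring)"
  have F_c: "F n = of_nat ((fact n)\<^sup>2) * c n" for n by (simp only: F_def c_def of_nat_mult)
  have main: "q dvd smult fm (hyp_poly m b)"
    if "horner_zero (int CARD('p)) (int m) (int b) u v n (int n) K s g0 g1" "n \<le> m"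
      "n > 0 \<Longrightarrow> of_int K * of_nat ((fact (n - 1))\<^sup>2) = fm"
      "n > 0 \<Longrightarrow> s = (int m + 1 - int n) * (int b + 1 - int n)"
      "q dvd monom (F n) n * [:of_int g0, of_int g1:] - smult fm (\<Sum>k=n..m. monom (c k) k)"
    for n K s g0 g1
    using that
  proof (induction n arbitrary: K s g0 g1)
    case 0
    hence "(of_int g0 :: 'p mod_ring) = 0" "(of_int g1 :: 'p mod_ring) = 0"
      by (simp_all add: of_int_mod_ring_eq_0_iff mod_eq_0_iff_dvd)
    hence "q dvd - smult fm (\<Sum>k=0..m. monom (c k) k)" using 0(5) by simp
    thus ?case by (simp add: hyp_poly_def c_def atLeast0AtMost)
  next
    case (Suc n)
    define K' where "K' = K * (int n * int n) mod int CARD('p)"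
    define g0' where "g0' = (K + s * v * g1) mod int CARD('p)"
    define g1' where "g1' = s * (g0 + u * g1) mod int CARD('p)"
    have K: "of_int K * of_nat ((fact n)\<^sup>2) = fm" using Suc.prems(3) by simp
    have s_eq: "s = (int m - int n) * (int b - int n)" using Suc.prems(4) by simp
    have s: "F (Suc n) = of_int s * F n"
      unfolding F_def s_eq by (rule choose_step)
    have K': "of_int K' * of_nat ((fact (n - 1))\<^sup>2) = fm" if "n > 0"
    proof -
      have "fact n = n * fact (n - 1)" using that by (simp add: fact_reduce)
      hence "(of_nat ((fact n)\<^sup>2) :: 'p mod_ring) = of_nat n * of_nat n * of_nat ((fact (n - 1))\<^sup>2)"
        by (simp only: power2_eq_square of_nat_mult mult_ac)
      thus ?thesis using K unfolding K'_def of_int_mod_card by (simp add: mult_ac)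
    qed
    have G: "[:of_int g0', of_int g1':] = [:of_int K:] + smult (of_int s) (pCons 0 [:of_int g0, of_int g1:])
        - smult (of_int s * of_int g1) q"
      unfolding g0'_def g1'_def of_int_mod_card by (simp add: q_def algebra_simps)
    have sum: "(\<Sum>k=n..m. monom (c k) k) = monom (c n) n + (\<Sum>k=Suc n..m. monom (c k) k)"
      using Suc.prems(2) by (simp add: sum.atLeast_Suc_atMost)
    have const: "monom (F n) n * [:of_int K:] = smult fm (monom (c n) n)"
      using K by (simp add: smult_monom F_c mult_ac)
    have shift: "monom (F n) n * smult (of_int s) (pCons 0 G) = monom (F (Suc n)) (Suc n) * G" for G
      by (simp add: s monom_Suc smult_monom[symmetric])
    have "monom (F n) n * [:of_int g0', of_int g1':] - smult fm (\<Sum>k=n..m. monom (c k) k) =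
      (monom (F (Suc n)) (Suc n) * [:of_int g0, of_int g1:] - smult fm (\<Sum>k=Suc n..m. monom (c k) k))
      - monom (F n) n * smult (of_int s * of_int g1) q"
      unfolding G sum right_diff_distrib distrib_left const shift smult_add_right by simp
    also have "q dvd \<dots>"
      by (rule dvd_diff[OF Suc.prems(5)]) (intro dvd_mult dvd_smult dvd_refl)
    finally have "q dvd monom (F n) n * [:of_int g0', of_int g1':] - smult fm (\<Sum>k=n..m. monom (c k) k)" .
    moreover have "horner_zero (int CARD('p)) (int m) (int b) u v n (int n) K'
        ((int m + 1 - int n) * (int b + 1 - int n)) g0' g1'"
      using Suc.prems(1) by (simp add: K'_def g0'_def g1'_def algebra_simps)
    ultimately show ?case using Suc.IH[of K' _ g0' g1'] Suc.prems(2) K' by simp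
  qed
  have "q dvd smult fm (hyp_poly m b)"
  proof (rule main)
    show "horner_zero (int CARD('p)) (int m) (int b) u v m (int m)
        (int m * int m mod int CARD('p)) (int b + 1 - int m) 1 0"
      using zero by (simp add: quadratic_zero_def)
    show "of_int (int m * int m mod int CARD('p)) * of_nat ((fact (m - 1))\<^sup>2) = fm" if "m > 0"
    proof -
      have "fact m = m * fact (m - 1)" using that by (simp add: fact_reduce)
      thus ?thesis unfolding fm_def of_int_mod_card
        by (simp only: power2_eq_square of_nat_mult mult_ac of_int_mult of_int_of_nat_eq)
    qed
    have "monom (F m) m * [:of_int 1, of_int 0:] - smult fm (\<Sum>k=m..m. monom (c k) k) = 0"
      by (simp add: fm_def F_c smult_monom del: of_nat_power of_nat_fact)
    thus "q dvd monom (F m) m * [:of_int 1, of_int 0:] - smult fm (\<Sum>k=m..m. monom (c k) k)" by simp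
  qed simp_all
  moreover have "fm \<noteq> 0"
  proof
    assume "fm = 0"
    hence "CARD('p) dvd (fact m)\<^sup>2" unfolding fm_def by (rule of_nat_0_mod_ring_dvd)
    hence "CARD('p) dvd fact m" using prime_card[where ?'a = 'p] by (metis prime_dvd_power)
    thus False using m prime_dvd_fact_iff[OF prime_card[where ?'a = 'p], of m] by simp
  qed
  ultimately show ?thesis by (simp add: dvd_smult_iff)
qed

text \<open>Binary exponentiation with accumulator \<open>r\<close>; the first argument bounds the
  number of binary digits of the exponent \<open>n\<close>.\<close>

primrec powmod :: "nat \<Rightarrow> int \<Rightarrow> int \<Rightarrow> int \<Rightarrow> int \<Rightarrow> int" where
  "powmod 0 p a n r = r"
| "powmod (Suc k) p a n r = powmod k p (a * a mod p) (n div 2) (if n mod 2 = 1 then r * a mod p else r)"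

lemma of_int_powmod:
  assumes "0 \<le> n" "n < 2 ^ k"
  shows "(of_int (powmod k (int CARD('p)) a n r) :: 'p::prime_card mod_ring) = of_int r * of_int a ^ nat n"
  using assms
proof (induction k arbitrary: a n r)
  case (Suc k)
  define j where "j = nat (n div 2)"
  have "0 \<le> n div 2" "n div 2 < 2 ^ k" using Suc.prems by auto
  from Suc.IH[OF this]
  have IH: "(of_int (powmod (Suc k) (int CARD('p)) a n r) :: 'p mod_ring) =
      of_int (if n mod 2 = 1 then r * a else r) * (of_int a * of_int a) ^ j"
    by (simp add: of_int_mod_card j_def)
  have "n = 2 * (n div 2) + n mod 2" by simp
  hence "nat n = 2 * j + nat (n mod 2)"
    using Suc.prems(1) unfolding j_def by (metis nat_add_distrib nat_mult_distrib nat_numeral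
        mult_nonneg_nonneg pos_imp_zdiv_nonneg_iff pos_mod_sign zero_le_numeral zero_less_numeral)
  moreover have "n mod 2 = 0 \<or> n mod 2 = 1" by presburger
  ultimately show ?case
    unfolding IH by (elim disjE) (simp_all add: power_mult power2_eq_square power_mult_distrib mult_ac)
qed simp

lemma degree_hyp_poly_le: "degree (hyp_poly m b :: 'a::comm_ring_1 poly) \<le> m"
  by (rule degree_le) (auto simp: coeff_hyp_poly binomial_eq_0)

lemma hyp_poly_nonzero: "(hyp_poly m b :: 'a::comm_ring_1 poly) \<noteq> 0"
proof
  assume "(hyp_poly m b :: 'a poly) = 0"
  hence "coeff (hyp_poly m b :: 'a poly) 0 = 0" by simp
  thus False by (simp add: coeff_hyp_poly)
qed

text \<open>The roots of the quadratic factor lie outside the prime field by Euler's criterion.\<close>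

lemma not_split_of_quadratic_factor:
  assumes zero: "quadratic_zero (int CARD('p::prime_card)) (int m) (int b) u v"
    and nonres: "powmod k (int CARD('p)) ((u * u + 4 * v) mod int CARD('p)) ((int CARD('p) - 1) div 2) 1 =
      int CARD('p) - 1" and k: "(int CARD('p) - 1) div 2 < 2 ^ k"
    and m: "m < CARD('p)" and p: "CARD('p) \<ge> 3"
  shows "size (proots (hyp_poly m b :: 'p mod_ring poly)) \<noteq> m"
proof
  assume "size (proots (hyp_poly m b :: 'p mod_ring poly)) = m"
  hence split: "size (proots (hyp_poly m b :: 'p mod_ring poly)) = degree (hyp_poly m b :: 'p mod_ring poly)"
    using degree_hyp_poly_le[of m b, where ?'a = "'p mod_ring"] size_proots_le[of "hyp_poly m b :: 'p mod_ring poly"] by linarith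
  define q where "q = ([:- of_int v, - of_int u, 1:] :: 'p mod_ring poly)"
  define h where "h = (CARD('p) - 1) div 2"
  have h: "2 * h = CARD('p) - 1"
    using prime_odd_nat[OF prime_card[where ?'a = 'p]] p by (simp add: h_def)
  from quadratic_zero_dvd[OF zero m] have "q dvd hyp_poly m b" unfolding q_def .
  from size_proots_dvd[OF split hyp_poly_nonzero this] have "size (proots q) = degree q" .
  also have "degree q = 2" by (simp add: q_def)
  finally have "proots q \<noteq> {#}" by auto
  then obtain a where "a \<in># proots q" by blast
  hence "poly q a = 0" by (simp add: q_def)
  hence a: "a * a = of_int u * a + of_int v" by (simp add: q_def algebra_simps)
  define w where "w = 2 * a - of_int u"
  define d where "d = (of_int (u * u + 4 * v) :: 'p mod_ring)"
  have "w\<^sup>2 = 4 * (a * a) - 4 * of_int u * a + of_int u * of_int u"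
    by (simp add: w_def power2_eq_square algebra_simps)
  also have "\<dots> = d" unfolding a d_def by (simp add: algebra_simps)
  finally have w: "w\<^sup>2 = d" .
  have "0 \<le> (int CARD('p) - 1) div 2" "nat ((int CARD('p) - 1) div 2) = h"
    using p by (simp_all add: h_def nat_div_distrib nat_diff_distrib)
  with of_int_powmod[OF _ k, of "(u * u + 4 * v) mod int CARD('p)" 1, where ?'p = 'p]
  have "d ^ h = of_int (int CARD('p) - 1)"
    unfolding nonres of_int_mod_card d_def by simp
  also have "of_int (int CARD('p) - 1) = (- 1 :: 'p mod_ring)" by simp
  finally have d: "d ^ h = - 1" .
  have pow: "w ^ (CARD('p) - 1) = d ^ h" by (simp only: w[symmetric] power_mult[symmetric] h)
  have "w \<noteq> 0"
  proof
    assume "w = 0"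
    hence "w ^ (CARD('p) - 1) = 0" using p by (simp add: power_0_left)
    thus False using d unfolding pow by simp
  qed
  from fermat_mod_ring[OF this] have "d ^ h = 1" unfolding pow .
  hence "(- 1 :: 'p mod_ring) = 1" using d by simp
  hence "(of_nat 2 :: 'p mod_ring) = 0" by (metis add.right_inverse numeral_One of_nat_numeral one_add_one)
  hence "CARD('p) dvd 2" by (rule of_nat_0_mod_ring_dvd)
  thus False using p by (auto dest: dvd_imp_le)
qed

text \<open>In an entry \<open>(z, t)\<close> the root \<open>z\<close> is certified together with a
  second root \<open>t\<close>, through the quadratic factor (X - z)(X - t). In this way the checker
  for irreducible factors also serves for roots.\<close>

definition roots_cert :: "int \<Rightarrow> int \<Rightarrow> int \<Rightarrow> (int \<times> int) list \<Rightarrow> bool" where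
  "roots_cert p m b ps \<longleftrightarrow> int (length ps) = m \<and> distinct (map fst ps) \<and>
     list_all (\<lambda>(z, t). 0 \<le> z \<and> z < p \<and> quadratic_zero p m b (z + t) (- (z * t))) ps"

lemma split_of_roots_cert:
  fixes ps :: "(int \<times> int) list"
  assumes cert: "roots_cert (int CARD('p::prime_card)) (int m) (int b) ps" and m: "m < CARD('p)"
  shows "size (proots (hyp_poly m b :: 'p mod_ring poly)) = m"
proof -
  have len: "length ps = m" and dist: "distinct (map fst ps)"
    and range: "\<forall>z\<in>set (map fst ps). 0 \<le> z \<and> z < int CARD('p)"
    and zero: "\<forall>(z, t)\<in>set ps. quadratic_zero (int CARD('p)) (int m) (int b) (z + t) (- (z * t))"
    using cert by (auto simp: roots_cert_def list_all_iff)
  let ?f = "hyp_poly m b :: 'p mod_ring poly"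
  have root: "poly ?f (of_int z) = 0" if z: "z \<in> set (map fst ps)" for z
  proof -
    obtain t where "(z, t) \<in> set ps" using z by auto
    hence "quadratic_zero (int CARD('p)) (int m) (int b) (z + t) (- (z * t))" using zero by blast
    from quadratic_zero_dvd[OF this m] obtain r
      where r: "?f = [:- of_int (- (z * t)), - of_int (z + t), 1:] * r" by (rule dvdE)
    have "poly [:- of_int (- (z * t)), - of_int (z + t), 1:] (of_int z :: 'p mod_ring) = 0"
      by (simp add: algebra_simps)
    thus ?thesis unfolding r poly_mult by (simp only: mult_zero_left)
  qed
  have inj: "inj_on (of_int :: int \<Rightarrow> 'p mod_ring) (set (map fst ps))"
  proof (rule inj_onI)
    fix x y assume xy: "x \<in> set (map fst ps)" "y \<in> set (map fst ps)" "(of_int x :: 'p mod_ring) = of_int y"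
    hence "(of_int (x - y) :: 'p mod_ring) = 0" by simp
    hence "int CARD('p) dvd x - y" by (simp only: of_int_mod_ring_eq_0_iff)
    hence "x mod int CARD('p) = y mod int CARD('p)" by (simp add: mod_eq_dvd_iff)
    moreover have "0 \<le> x" "x < int CARD('p)" "0 \<le> y" "y < int CARD('p)" using xy range by blast+
    ultimately show "x = y" by simp
  qed
  have "m = card ((of_int :: int \<Rightarrow> 'p mod_ring) ` set (map fst ps))"
    using card_image[OF inj] distinct_card[OF dist] len by simp
  also have "\<dots> \<le> card (set_mset (proots ?f))"
    using root hyp_poly_nonzero[of m b, where ?'a = "'p mod_ring"] by (intro card_mono) auto
  also have "\<dots> \<le> size (proots ?f)"
    unfolding size_multiset_overloaded_eq card_eq_sum by (intro sum_mono) (simp add: Suc_le_eq)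
  finally show ?thesis
    using degree_hyp_poly_le[of m b, where ?'a = "'p mod_ring"] size_proots_le[of ?f] by linarith
qed

lemma split_of_le_1:
  fixes m b :: nat
  assumes "m \<le> 1" "m \<le> b" "b < CARD('p::prime_card)"
  shows "size (proots (hyp_poly m b :: 'p mod_ring poly)) = m"
proof -
  have "\<not> CARD('p) dvd (b choose m)"
  proof (cases "m = 0")
    case True
    thus ?thesis using prime_gt_1_nat[OF prime_card[where ?'a = 'p]] by simp
  next
    case False
    hence "m = 1" using assms(1) by simp
    thus ?thesis using assms(2,3) nat_dvd_not_less[of b "CARD('p)"] by simp
  qed
  hence "of_nat (b choose m) \<noteq> (0 :: 'p mod_ring)" using of_nat_0_mod_ring_dvd by blast
  hence "coeff (hyp_poly m b :: 'p mod_ring poly) m \<noteq> 0" by (simp add: coeff_hyp_poly)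
  hence deg: "degree (hyp_poly m b :: 'p mod_ring poly) = m"
    by (intro antisym degree_hyp_poly_le le_degree)
  have "size (proots (hyp_poly m b :: 'p mod_ring poly)) = degree (hyp_poly m b :: 'p mod_ring poly)"
    by (rule size_proots_linear) (simp_all only: deg assms(1) hyp_poly_nonzero not_False_eq_True)
  thus ?thesis by (simp only: deg)
qed

text \<open>An entry \<open>(p, u, v)\<close> records the irreducible factor \<open>X\<^sup>2 - u X - v\<close> modulo \<open>p\<close>.\<close>

definition certs2 :: "(int \<times> int \<times> int) list" where
  "certs2 = [
    (29,22,13), (37,23,3), (41,33,40), (43,40,7), (53,8,40), (59,11,32), (61,7,41),
    (67,17,41), (71,14,53), (73,15,65), (79,33,15), (83,4,76), (89,19,87), (97,31,61),
    (101,86,96), (103,44,70), (107,32,24), (109,51,71), (113,26,81), (127,10,77), (131,2,119),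
    (137,11,59), (139,16,134), (149,19,24), (151,0,27), (157,22,105), (163,18,28), (167,0,80),
    (173,17,116), (179,2,6), (181,8,137), (191,12,137), (193,1,109), (197,17,96), (199,26,74),
    (211,36,155), (223,4,99), (227,28,124), (229,5,226), (233,15,196), (239,33,140),
    (241,24,58), (251,5,166), (257,3,256), (263,8,119), (269,19,133), (271,12,150),
    (277,8,62), (281,13,141), (283,39,183), (293,24,260), (307,44,151), (311,67,132),
    (313,61,121), (317,7,136), (331,13,201), (337,49,26), (347,6,308), (349,15,308),
    (353,5,265), (359,35,189), (367,12,194), (373,3,333), (379,2,7), (383,22,94), (389,6,308),
    (397,11,277), (401,16,88), (409,29,345), (419,5,246), (421,11,269), (431,20,393),
    (433,1,22), (439,111,75), (443,4,332), (449,30,367), (457,1,1), (461,67,100),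
    (463,38,241), (467,16,282), (479,20,34), (487,13,294), (491,8,285), (499,2,312),
    (503,0,267), (509,18,493)]"

text \<open>The list ends below 288, where \<open>hyp3_not_split_of_large_prime\<close> takes
  over.\<close>

definition certs3 :: "(int \<times> int \<times> int) list" where
  "certs3 = [
    (19,2,2), (31,8,27), (37,13,28), (41,3,2), (43,7,39), (47,7,38), (53,6,42), (59,20,11),
    (61,1,13), (67,6,2), (71,21,35), (73,42,48), (79,16,54), (83,0,80), (89,4,2), (97,7,94),
    (101,16,9), (103,1,75), (107,0,98), (109,45,16), (113,4,41), (127,13,80), (131,9,14),
    (137,18,2), (139,15,12), (149,72,132), (151,9,146), (157,10,67), (163,2,147), (167,54,52),
    (173,4,119), (179,0,160), (181,31,137), (191,48,139), (193,6,145), (197,17,105),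
    (199,2,75), (211,18,31), (223,0,118), (227,2,216), (229,1,16), (233,36,63), (239,4,175),
    (241,18,212), (251,1,167), (257,23,234), (263,0,252), (269,3,224), (271,5,193),
    (277,14,193), (281,5,232), (283,32,282)]"

fun cert2_zero :: "int \<times> int \<times> int \<Rightarrow> bool" where
  "cert2_zero (p, u, v) = quadratic_zero p (p div 8) (3 * p div 8) u v"

fun cert3_zero :: "int \<times> int \<times> int \<Rightarrow> bool" where
  "cert3_zero (p, u, v) = quadratic_zero p (p div 6) (p div 3) u v"

lemma certs2_zero: "list_all cert2_zero certs2"
  by code_simp

lemma certs3_zero: "list_all cert3_zero certs3"
  by code_simp

definition primes_below_512 :: "int list" where
  "primes_below_512 = [
    5, 7, 11, 13, 17, 19, 23, 29, 31, 37, 41, 43, 47, 53, 59, 61, 67, 71, 73, 79, 83, 89, 97,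
    101, 103, 107, 109, 113, 127, 131, 137, 139, 149, 151, 157, 163, 167, 173, 179, 181, 191,
    193, 197, 199, 211, 223, 227, 229, 233, 239, 241, 251, 257, 263, 269, 271, 277, 281, 283,
    293, 307, 311, 313, 317, 331, 337, 347, 349, 353, 359, 367, 373, 379, 383, 389, 397, 401,
    409, 419, 421, 431, 433, 439, 443, 449, 457, 461, 463, 467, 479, 487, 491, 499, 503, 509]"

lemma small_primes:
  assumes "prime (p :: nat)" "5 \<le> p" "p < 512"
  shows "int p \<in> set primes_below_512"
proof -
  have primes: "\<forall>d\<in>set [2, 3, 5, 7, 11, 13, 17, 19 :: int]. prime (nat d) \<and> 0 < d" by simp
  have eq: "int p mod d = 0 \<longrightarrow> int p = d" if "prime (nat d) \<and> 0 < d" for d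
  proof
    assume "int p mod d = 0"
    hence "nat d dvd p" using that by (simp add: mod_eq_0_iff_dvd nat_dvd_iff)
    thus "int p = d" using primes_dvd_imp_eq[of "nat d" p] that assms(1) by auto
  qed
  \<comment> \<open>Trial division up to 19 is enough for a complete sieve, since 23^2 = 529 exceeds
    511.\<close>
  have "list_all (\<lambda>d. int p mod d = 0 \<longrightarrow> int p = d) [2, 3, 5, 7, 11, 13, 17, 19]"
    unfolding list_all_iff by (rule ballI, rule eq, rule bspec[OF primes])
  moreover have "int p \<in> set [5..511]" unfolding set_upto using assms(2,3) by simp
  ultimately have "int p \<in> set (filter (\<lambda>n. list_all (\<lambda>d. n mod d = 0 \<longrightarrow> n = d) [2, 3, 5, 7, 11, 13, 17, 19]) [5..511])"
    unfolding set_filter by (intro CollectI conjI)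
  also have "filter (\<lambda>n. list_all (\<lambda>d. n mod d = 0 \<longrightarrow> n = d) [2, 3, 5, 7, 11, 13, 17, 19]) [5..511] = primes_below_512"
    by code_simp
  finally show ?thesis .
qed

text \<open>Eight binary digits suffice for the exponent in Euler's criterion, since
  \<open>p < 512\<close> gives \<open>(p - 1) div 2 < 256\<close>.\<close>

fun cert_nonresidue :: "int \<times> int \<times> int \<Rightarrow> bool" where
  "cert_nonresidue (p, u, v) \<longleftrightarrow> p < 512 \<and> powmod 8 p ((u * u + 4 * v) mod p) ((p - 1) div 2) 1 = p - 1"

lemma certs_nonresidue: "list_all cert_nonresidue certs2" "list_all cert_nonresidue certs3"
  by code_simp+

lemma certs2_primes: "list_all (\<lambda>n. n \<in> set (map fst certs2) \<or> n \<in> {5, 7, 11, 13, 17, 19, 23, 31, 47}) primes_below_512"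
  by code_simp

lemma certs3_primes:
  "list_all (\<lambda>n. n \<ge> 288 \<or> n \<in> set (map fst certs3) \<or> n \<in> {5, 7, 11, 13, 17, 23, 29}) primes_below_512"
  by code_simp

lemma hyp2_not_split_of_cert:
  assumes "(int CARD('p::prime_card), u, v) \<in> set certs2" "CARD('p) \<ge> 5"
  shows "size (proots (hyp_poly (CARD('p) div 8) (3 * CARD('p) div 8) :: 'p mod_ring poly)) \<noteq> CARD('p) div 8"
proof (rule not_split_of_quadratic_factor)
  have div: "int CARD('p) div 8 = int (CARD('p) div 8)" "3 * int CARD('p) div 8 = int (3 * CARD('p) div 8)"
    by (simp_all add: zdiv_int)
  have "cert2_zero (int CARD('p), u, v)"
    using certs2_zero assms(1) unfolding list_all_iff by blast
  thus "quadratic_zero (int CARD('p)) (int (CARD('p) div 8)) (int (3 * CARD('p) div 8)) u v"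
    by (simp only: cert2_zero.simps div)
  have "cert_nonresidue (int CARD('p), u, v)"
    using certs_nonresidue(1) assms(1) unfolding list_all_iff by blast
  thus "powmod 8 (int CARD('p)) ((u * u + 4 * v) mod int CARD('p)) ((int CARD('p) - 1) div 2) 1 =
      int CARD('p) - 1" "(int CARD('p) - 1) div 2 < 2 ^ 8" by auto
qed (use assms(2) in auto)

lemma hyp3_not_split_of_cert:
  assumes "(int CARD('p::prime_card), u, v) \<in> set certs3" "CARD('p) \<ge> 5"
  shows "size (proots (hyp_poly (CARD('p) div 6) (CARD('p) div 3) :: 'p mod_ring poly)) \<noteq> CARD('p) div 6"
proof (rule not_split_of_quadratic_factor)
  have div: "int CARD('p) div 6 = int (CARD('p) div 6)" "int CARD('p) div 3 = int (CARD('p) div 3)"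
    by (simp_all add: zdiv_int)
  have "cert3_zero (int CARD('p), u, v)"
    using certs3_zero assms(1) unfolding list_all_iff by blast
  thus "quadratic_zero (int CARD('p)) (int (CARD('p) div 6)) (int (CARD('p) div 3)) u v"
    by (simp only: cert3_zero.simps div)
  have "cert_nonresidue (int CARD('p), u, v)"
    using certs_nonresidue(2) assms(1) unfolding list_all_iff by blast
  thus "powmod 8 (int CARD('p)) ((u * u + 4 * v) mod int CARD('p)) ((int CARD('p) - 1) div 2) 1 =
      int CARD('p) - 1" "(int CARD('p) - 1) div 2 < 2 ^ 8" by auto
qed (use assms(2) in auto)

lemma hyp2_split:
  assumes "CARD('p::prime_card) \<in> {5, 7, 11, 13, 17, 19, 23, 31, 47}"
  shows "size (proots (hyp_poly (CARD('p) div 8) (3 * CARD('p) div 8) :: 'p mod_ring poly)) = CARD('p) div 8"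
proof -
  consider "CARD('p) \<in> {5, 7, 11, 13}" | "CARD('p) = 17" | "CARD('p) = 19" | "CARD('p) = 23" | "CARD('p) = 31" | "CARD('p) = 47"
    using assms by auto
  thus ?thesis
  proof cases
    case 1
    thus ?thesis by (intro split_of_le_1) auto
  next
    case 2
    have "roots_cert 17 2 6 [(2, 4), (4, 2)]" by code_simp
    thus ?thesis using 2 split_of_roots_cert[of 2 6, where ?'p = 'p] by simp
  next
    case 3
    have "roots_cert 19 2 7 [(14, 17), (17, 14)]" by code_simp
    thus ?thesis using 3 split_of_roots_cert[of 2 7, where ?'p = 'p] by simp
  next
    case 4
    have "roots_cert 23 2 8 [(11, 18), (18, 11)]" by code_simp
    thus ?thesis using 4 split_of_roots_cert[of 2 8, where ?'p = 'p] by simp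
  next
    case 5
    have "roots_cert 31 3 11 [(18, 20), (20, 23), (23, 18)]" by code_simp
    thus ?thesis using 5 split_of_roots_cert[of 3 11, where ?'p = 'p] by simp
  next
    case 6
    have "roots_cert 47 5 17 [(2, 12), (12, 21), (21, 40), (40, 46), (46, 2)]" by code_simp
    thus ?thesis using 6 split_of_roots_cert[of 5 17, where ?'p = 'p] by simp
  qed
qed

lemma hyp3_split:
  assumes "CARD('p::prime_card) \<in> {5, 7, 11, 13, 17, 23, 29}"
  shows "size (proots (hyp_poly (CARD('p) div 6) (CARD('p) div 3) :: 'p mod_ring poly)) = CARD('p) div 6"
proof -
  consider "CARD('p) \<in> {5, 7, 11}" | "CARD('p) = 13" | "CARD('p) = 17" | "CARD('p) = 23" | "CARD('p) = 29"
    using assms by auto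
  thus ?thesis
  proof cases
    case 1
    thus ?thesis by (intro split_of_le_1) auto
  next
    case 2
    have "roots_cert 13 2 4 [(7, 9), (9, 7)]" by code_simp
    thus ?thesis using 2 split_of_roots_cert[of 2 4, where ?'p = 'p] by simp
  next
    case 3
    have "roots_cert 17 2 5 [(7, 9), (9, 7)]" by code_simp
    thus ?thesis using 3 split_of_roots_cert[of 2 5, where ?'p = 'p] by simp
  next
    case 4
    have "roots_cert 23 3 7 [(2, 12), (12, 21), (21, 2)]" by code_simp
    thus ?thesis using 4 split_of_roots_cert[of 3 7, where ?'p = 'p] by simp
  next
    case 5
    have "roots_cert 29 4 9 [(18, 23), (23, 25), (25, 28), (28, 18)]" by code_simp
    thus ?thesis using 5 split_of_roots_cert[of 4 9, where ?'p = 'p] by simp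
  qed
qed

section \<open>Prime divisors of the group orders and the conclusion\<close>

lemma dvd_order_Baby_Monster_iff:
  assumes "prime p"
  shows "p dvd order_Baby_Monster \<longleftrightarrow> p \<in> {2, 3, 5, 7, 11, 13, 17, 19, 23, 31, 47}"
proof
  assume "p dvd order_Baby_Monster"
  hence "p dvd 2 \<or> p dvd 3 \<or> p dvd 5 \<or> p dvd 7 \<or> p dvd 11 \<or> p dvd 13 \<or> p dvd 17 \<or> p dvd 19 \<or> p dvd 23 \<or>
      p dvd 31 \<or> p dvd 47"
    unfolding order_Baby_Monster_def by (simp only: prime_dvd_mult_iff[OF assms]) (metis assms prime_dvd_power)
  moreover have "p = q" if "p dvd q" "prime q" for q using primes_dvd_imp_eq[OF assms that(2,1)] .
  ultimately show "p \<in> {2, 3, 5, 7, 11, 13, 17, 19, 23, 31, 47}" by auto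
qed (auto simp: order_Baby_Monster_def)

lemma dvd_order_Fischer_24_iff:
  assumes "prime p"
  shows "p dvd order_Fischer_24' \<longleftrightarrow> p \<in> {2, 3, 5, 7, 11, 13, 17, 23, 29}"
proof
  assume "p dvd order_Fischer_24'"
  hence "p dvd 2 \<or> p dvd 3 \<or> p dvd 5 \<or> p dvd 7 \<or> p dvd 11 \<or> p dvd 13 \<or> p dvd 17 \<or> p dvd 23 \<or> p dvd 29"
    unfolding order_Fischer_24'_def by (simp only: prime_dvd_mult_iff[OF assms]) (metis assms prime_dvd_power)
  moreover have "p = q" if "p dvd q" "prime q" for q using primes_dvd_imp_eq[OF assms that(2,1)] .
  ultimately show "p \<in> {2, 3, 5, 7, 11, 13, 17, 23, 29}" by auto
qed (auto simp: order_Fischer_24'_def)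

lemma hyp2_split_iff:
  assumes "CARD('p::prime_card) \<ge> 5"
  shows "size (proots (hyp_poly (CARD('p) div 8) (3 * CARD('p) div 8) :: 'p mod_ring poly)) = CARD('p) div 8
    \<longleftrightarrow> CARD('p) \<in> {5, 7, 11, 13, 17, 19, 23, 31, 47}"
proof
  assume split: "size (proots (hyp_poly (CARD('p) div 8) (3 * CARD('p) div 8) :: 'p mod_ring poly)) = CARD('p) div 8"
  hence "CARD('p) < 512" using hyp2_not_split_of_large_prime[where ?'p = 'p] by linarith
  hence "int CARD('p) \<in> set primes_below_512" using small_primes[OF prime_card assms] by blast
  hence "int CARD('p) \<in> fst ` set certs2 \<or> int CARD('p) \<in> {5, 7, 11, 13, 17, 19, 23, 31, 47}"
    using certs2_primes unfolding list_all_iff set_map by blast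
  moreover have "int CARD('p) \<notin> fst ` set certs2"
    using split hyp2_not_split_of_cert[OF _ assms] by fastforce
  ultimately show "CARD('p) \<in> {5, 7, 11, 13, 17, 19, 23, 31, 47}" by auto
qed (rule hyp2_split)

lemma hyp3_split_iff:
  assumes "CARD('p::prime_card) \<ge> 5"
  shows "size (proots (hyp_poly (CARD('p) div 6) (CARD('p) div 3) :: 'p mod_ring poly)) = CARD('p) div 6
    \<longleftrightarrow> CARD('p) \<in> {5, 7, 11, 13, 17, 23, 29}"
proof
  assume split: "size (proots (hyp_poly (CARD('p) div 6) (CARD('p) div 3) :: 'p mod_ring poly)) = CARD('p) div 6"
  hence lt: "CARD('p) < 288" using hyp3_not_split_of_large_prime[where ?'p = 'p] by linarith
  hence "int CARD('p) \<in> set primes_below_512" using small_primes[OF prime_card assms] by simp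
  hence "int CARD('p) \<in> fst ` set certs3 \<or> int CARD('p) \<in> {5, 7, 11, 13, 17, 23, 29}"
    using certs3_primes lt unfolding list_all_iff set_map by fastforce
  moreover have "int CARD('p) \<notin> fst ` set certs3"
    using split hyp3_not_split_of_cert[OF _ assms] by fastforce
  ultimately show "CARD('p) \<in> {5, 7, 11, 13, 17, 23, 29}" by auto
qed (rule hyp3_split)

theorem theorem1p6:
  shows "(degree (ss2 :: 'p::prime_card mod_ring poly) = num_linear_factors (ss2 :: 'p mod_ring poly)
            \<longleftrightarrow> CARD('p) dvd order_Baby_Monster) \<and>
         (degree (ss3 :: 'p mod_ring poly) = num_linear_factors (ss3 :: 'p mod_ring poly)
            \<longleftrightarrow> CARD('p) dvd order_Fischer_24')"
proof (cases "CARD('p) \<in> {2, 3}")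
  case True
  \<comment> \<open>For 2 and 3 both polynomials are X, which is its own linear factor, and both
    primes divide both orders.\<close>
  have "num_linear_factors ([:0, 1:] :: 'p mod_ring poly) = 1"
    using num_linear_factors_eq_size_proots[of "[:0, 1:] :: 'p mod_ring poly"] by simp
  thus ?thesis
    using True by (auto simp: ss2_def ss3_def dvd_order_Baby_Monster_iff[OF prime_card] dvd_order_Fischer_24_iff[OF prime_card])
next
  case False
  have "CARD('p) \<noteq> 4" using prime_card[where ?'a = 'p] by auto
  hence "CARD('p) \<ge> 5" using False prime_ge_2_nat[OF prime_card[where ?'a = 'p]] by auto
  note 5 = this
  show ?thesis
    unfolding ss2_split_iff[OF 5] ss3_split_iff[OF 5] hyp2_split_iff[OF 5] hyp3_split_iff[OF 5]
      dvd_order_Baby_Monster_iff[OF prime_card] dvd_order_Fischer_24_iff[OF prime_card]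
    using False by simp
qed

end
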